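(* The following hold. (a) Let $k=3$. For every $\varepsilon>0$ there exists a constant $c>0$ such that for every function $p=p(n)\in[0,1]$ with $p\ge \frac{c\log n}{n^2}$, $$\lim_{\substack{n\to\infty\\ 2\mid n}}\Pr\left[H^{(3)}_{n,p}\text{ contains a loose Hamilton cycle}\right]\ge 1-\varepsilon .$$ (b) Let $k\ge 4$ be a fixed integer and let $p=p(n)\in[0,1]$ be such that $pn^{k-1}/\log n\to\infty$ as $n\to\infty$. Then $$\lim_{\substack{n\to\infty\\ (k-1)\mid n}}\Pr\left[H^{(k)}_{n,p}\text{ contains a loose Hamilton cycle}\right]=1 .$$
   Context: $H^{(k)}_{n,p}$ denotes the random $k$-uniform hypergraph on vertex set $[n]=\{1,\dots,n\}$ in which each of the $\binom nk$ $k$-element subsets of $[n]$ is included as an edge independently with probability $p$. A loose Hamilton cycle in a $k$-uniform hypergraph on $n$ vertices is a cyclic ordering of the vertex set together with edges $e_1,\dots,e_m$ of the hypergraph, $m=n/(k-1)$, listed in cyclic order, each consisting of $k$ vertices that are consecutive in the cyclic ordering, such that every two cyclically consecutive edges satisfy $|e_i\cap e_{i+1}|=1$ (indices modulo $m$). Thus the last vertex of $e_i$ is the first vertex of $e_{i+1}$, and the edges cover all vertices. Such a cycle can exist only if $(k-1)\mid n$. The limits are taken along those $n$ satisfying the indicated divisibility condition. *)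

theory Defs
  imports "HOL-Probability.Probability"
begin

definition k_subsets :: "nat \<Rightarrow> 'a set \<Rightarrow> 'a set set" where
  "k_subsets k V = {e. e \<subseteq> V \<and> card e = k}"

text \<open>The binomial random hypergraph, as a distribution on edge sets over the vertex set
  \<open>{1..n}\<close>: independent coins with success probability \<open>p\<close>, one for each \<open>k\<close>-subset.
  (Outside \<open>0 \<le> p \<le> 1\<close> the library's Bernoulli distribution clips \<open>p\<close>.)\<close>

definition random_hypergraph :: "nat \<Rightarrow> nat \<Rightarrow> real \<Rightarrow> nat set set pmf" where
  "random_hypergraph k n p =
     map_pmf (\<lambda>coin. {e \<in> k_subsets k {1..n}. coin e})
       (Pi_pmf (k_subsets k {1..n}) False (\<lambda>_. bernoulli_pmf p))"

text \<open>A cyclic ordering of an \<open>n\<close>-element vertex set is given by an enumeration \<open>v\<close> on the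
  positions \<open>0, \<dots>, n - 1\<close>, read modulo \<open>n\<close>. The following is the set of the \<open>k\<close> consecutive
  vertices beginning at position \<open>s\<close>.\<close>

definition cyclic_segment :: "nat \<Rightarrow> (nat \<Rightarrow> 'a) \<Rightarrow> nat \<Rightarrow> nat \<Rightarrow> 'a set" where
  "cyclic_segment n v k s = (\<lambda>j. v ((s + j) mod n)) ` {..<k}"

text \<open>The edges of the cycle are indexed by \<open>0, \<dots>, m - 1\<close>, and edge \<open>i\<close> begins at position \<open>s i\<close>.
  That the edges are listed in cyclic order is expressed by the starting positions increasing
  within one turn; this loses nothing, as one may begin the list with the edge whose starting
  position is smallest. Since the \<open>m\<close> gaps between cyclically consecutive starting positions sum to
  \<open>card V = m * (k - 1)\<close>, and a gap below \<open>k - 1\<close> would give an intersection with at least two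
  vertices, all gaps equal \<open>k - 1\<close>. So each edge begins at the last vertex of the preceding one,
  and the edges cover \<open>V\<close>.\<close>

definition has_loose_hamilton_cycle :: "nat \<Rightarrow> 'a set \<Rightarrow> 'a set set \<Rightarrow> bool" where
  "has_loose_hamilton_cycle k V E \<longleftrightarrow>
     (\<exists>v s m. bij_betw v {..<card V} V \<and>
        0 < m \<and> m * (k - 1) = card V \<and>
        strict_mono_on {..<m} s \<and> s ` {..<m} \<subseteq> {..<card V} \<and>
        (\<forall>i<m. cyclic_segment (card V) v k (s i) \<in> E) \<and>
        (\<forall>i<m. card (cyclic_segment (card V) v k (s i) \<inter>
                     cyclic_segment (card V) v k (s ((i + 1) mod m))) = 1))"

definition multiples_at_top :: "nat \<Rightarrow> nat filter" where
  "multiples_at_top d = inf sequentially (principal {n. d dvd n})"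

end

theory Submission
  imports Defs "HOL-Combinatorics.Multiset_Permutations"
begin

text \<open>Sprinkle \<open>M\<close> (about \<open>log n\<close>) independent random edge sets \<open>W\<close> of density \<open>C / n ^ (k - 1)\<close>. In each round,
  replace the current family of target edge sets by the inclusion-minimal members of its trace
  outside \<open>W\<close>. Following Park and Pham, traces of more than half the current size bound can be
  discarded, because they form a family of small expected cost \<open>\<Sum>T. q ^ card T\<close>. After the size
  bound has been halved to \<open>0\<close>, either the union of the rounds contains a target, or the discarded
  traces cover all targets at cost below \<open>1\<close>. The latter is impossible when the targets carry a
  \<open>q\<close>-spread distribution. For the targets we take loose Hamilton cycles with a fixed partition of
  the vertices into links and \<open>k - 2\<close> classes of interior vertices: a uniformly random such
  cycle contains any given \<open>t\<close> edges with probability at most \<open>(C / n ^ (k - 1)) ^ t\<close>.\<close>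

section \<open>Random subsets\<close>

lemma prob_bind_pmf:
  "measure_pmf.prob (bind_pmf M f) A = measure_pmf.expectation M (\<lambda>x. measure_pmf.prob (f x) A)"
proof -
  have eq: "measure_pmf.prob N A = pmf (map_pmf (\<lambda>x. x \<in> A) N) True" for N
    by (simp add: pmf_map vimage_def)
  show ?thesis
    unfolding eq by (simp add: map_bind_pmf pmf_bind)
qed

definition random_subset :: "'a set \<Rightarrow> real \<Rightarrow> 'a set pmf" where
  "random_subset X p = map_pmf (\<lambda>c. {x \<in> X. c x}) (Pi_pmf X False (\<lambda>_. bernoulli_pmf p))"

lemma set_pmf_random_subset: "set_pmf (random_subset X p) \<subseteq> Pow X"
  by (auto simp: random_subset_def)

lemma pmf_random_subset:
  assumes "finite X" "W \<subseteq> X" "0 \<le> p" "p \<le> 1"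
  shows "pmf (random_subset X p) W = p ^ card W * (1 - p) ^ card (X - W)"
proof -
  let ?M = "Pi_pmf X False (\<lambda>_. bernoulli_pmf p)"
  have inj: "inj_on (\<lambda>c. {x \<in> X. c x}) (set_pmf ?M)"
  proof (rule inj_onI)
    fix c d assume *: "c \<in> set_pmf ?M" "d \<in> set_pmf ?M" "{x \<in> X. c x} = {x \<in> X. d x}"
    have "\<And>x. x \<notin> X \<Longrightarrow> c x = False \<and> d x = False"
      using *(1,2) set_Pi_pmf_subset[OF assms(1), of False] by blast
    with *(3) show "c = d" by (auto simp: fun_eq_iff)
  qed
  show ?thesis
  proof (cases "(\<lambda>x. x \<in> W) \<in> set_pmf ?M")
    case True
    have "pmf (random_subset X p) {x \<in> X. x \<in> W} = pmf ?M (\<lambda>x. x \<in> W)"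
      unfolding random_subset_def by (rule pmf_map_inj[OF inj True])
    also have "\<dots> = (\<Prod>x\<in>X. pmf (bernoulli_pmf p) (x \<in> W))"
      using assms by (intro pmf_Pi') auto
    also have "\<dots> = (\<Prod>x\<in>W. pmf (bernoulli_pmf p) (x \<in> W)) * (\<Prod>x\<in>X - W. pmf (bernoulli_pmf p) (x \<in> W))"
      using assms by (metis mult.commute prod.subset_diff)
    also have "\<dots> = p ^ card W * (1 - p) ^ card (X - W)"
      using assms by simp
    finally show ?thesis using assms by (simp add: Collect_conj_eq Int_absorb1)
  next
    \<comment> \<open>For \<open>p\<close> equal to 0 or 1 the indicator of \<open>W\<close> may lie
      outside the support; both sides are then 0.\<close>
    case False
    have "0 = pmf ?M (\<lambda>x. x \<in> W)"
      using False by (simp add: set_pmf_iff)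
    also have "\<dots> = (\<Prod>x\<in>X. pmf (bernoulli_pmf p) (x \<in> W))"
      using assms by (intro pmf_Pi') auto
    also have "\<dots> = (\<Prod>x\<in>W. pmf (bernoulli_pmf p) (x \<in> W)) * (\<Prod>x\<in>X - W. pmf (bernoulli_pmf p) (x \<in> W))"
      using assms by (metis mult.commute prod.subset_diff)
    also have "\<dots> = p ^ card W * (1 - p) ^ card (X - W)"
      using assms by simp
    finally have "p ^ card W * (1 - p) ^ card (X - W) = 0" by simp
    moreover have "W \<notin> set_pmf (random_subset X p)"
    proof
      assume "W \<in> set_pmf (random_subset X p)"
      then obtain c where c: "c \<in> set_pmf ?M" "W = {x \<in> X. c x}"
        by (auto simp: random_subset_def)
      have "\<And>x. x \<notin> X \<Longrightarrow> c x = False"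
        using c(1) set_Pi_pmf_subset[OF assms(1), of False] by blast
      then have "c = (\<lambda>x. x \<in> W)" unfolding c(2) by (auto simp: fun_eq_iff)
      with c(1) False show False by metis
    qed
    ultimately show ?thesis by (simp add: set_pmf_iff)
  qed
qed

lemma expectation_random_subset:
  fixes f :: "'a set \<Rightarrow> real"
  assumes "finite X"
  shows "measure_pmf.expectation (random_subset X p) f
         = (\<Sum>W\<in>Pow X. pmf (random_subset X p) W * f W)"
  using assms set_pmf_random_subset[of X p]
  by (subst integral_measure_pmf_real[of "Pow X"]) (auto simp: mult.commute)

lemma sum_pmf_random_subset:
  assumes "finite X"
  shows "(\<Sum>W\<in>Pow X. pmf (random_subset X p) W) = 1"
  using assms set_pmf_random_subset[of X p] by (intro sum_pmf_eq_1) auto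

text \<open>Adding \<open>T\<close> turns \<open>card T\<close> of the factors \<open>1 - p\<close>
  into factors \<open>p\<close>, and the former are at most 1. This is the price of passing from
  \<open>W\<close> to \<open>W \<union> T\<close> in \<open>large_fragments_cost\<close>.\<close>

lemma pmf_random_subset_disjoint_Un:
  assumes "finite X" "W \<subseteq> X" "T \<subseteq> X" "W \<inter> T = {}" "0 \<le> p" "p \<le> 1"
  shows "pmf (random_subset X p) W * p ^ card T \<le> pmf (random_subset X p) (W \<union> T)"
proof -
  have "card (X - W) = card ((X - (W \<union> T)) \<union> T)"
    using assms by (intro arg_cong[of _ _ card]) blast
  also have "\<dots> = card (X - (W \<union> T)) + card T"
    using assms by (intro card_Un_disjoint) (auto dest: finite_subset)
  finally have "card (X - W) = card (X - (W \<union> T)) + card T" .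
  moreover have "card (W \<union> T) = card W + card T"
    using assms by (meson card_Un_disjoint finite_subset)
  moreover have "(1 - p) ^ card T \<le> 1"
    using assms by (simp add: power_le_one)
  ultimately show ?thesis
    using assms mult_left_le[of "(1 - p) ^ card T" "p ^ card W * (p ^ card T * (1 - p) ^ card (X - (W \<union> T)))"]
    by (simp add: pmf_random_subset power_add mult_ac)
qed

text \<open>Two-round exposure: an element is missed only if both coins miss it. The identity is
  checked on a single coin and carried over to the product.\<close>

lemma random_subset_Un:
  assumes "finite X" "0 \<le> p" "p \<le> 1" "0 \<le> p'" "p' \<le> 1"
  shows "random_subset X (1 - (1 - p) * (1 - p'))
         = random_subset X p \<bind> (\<lambda>W. map_pmf (\<lambda>W'. W \<union> W') (random_subset X p'))"
proof -
  let ?B = bernoulli_pmf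
  have r: "0 \<le> 1 - (1 - p) * (1 - p')" "1 - (1 - p) * (1 - p') \<le> 1"
    using assms by (auto simp: mult_le_one)
  have or: "(\<lambda>b. map_pmf (\<lambda>b'. b \<or> b') (?B p')) = (\<lambda>b. if b then return_pmf True else ?B p')"
  proof
    fix b
    have "(\<or>) True = (\<lambda>_. True)" "(\<or>) False = (\<lambda>b. b)" by (simp_all add: fun_eq_iff)
    then show "map_pmf (\<lambda>b'. b \<or> b') (?B p') = (if b then return_pmf True else ?B p')"
      by (cases b) (simp_all add: map_pmf_const)
  qed
  have "pmf (?B (1 - (1 - p) * (1 - p'))) i = pmf (?B p \<bind> (\<lambda>b. if b then return_pmf True else ?B p')) i" for i
    using assms r by (cases i) (simp_all add: pmf_bind algebra_simps)
  then have coin: "?B (1 - (1 - p) * (1 - p')) = ?B p \<bind> (\<lambda>b. map_pmf (\<lambda>b'. b \<or> b') (?B p'))"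
    unfolding or by (rule pmf_eqI)
  let ?P = "\<lambda>p. Pi_pmf X False (\<lambda>_. ?B p)"
  have 1: "?P (1 - (1 - p) * (1 - p'))
      = ?P p \<bind> (\<lambda>c. Pi_pmf X False (\<lambda>x. map_pmf (\<lambda>b'. c x \<or> b') (?B p')))"
    unfolding coin
    using Pi_pmf_bind[OF assms(1), of False "\<lambda>_. ?B p" "\<lambda>_ b. map_pmf (\<lambda>b'. b \<or> b') (?B p')" False] .
  have 2: "Pi_pmf X False (\<lambda>x. map_pmf (\<lambda>b'. c x \<or> b') (?B p'))
      = map_pmf (\<lambda>c' x. if x \<in> X then c x \<or> c' x else False) (?P p')" for c
    using Pi_pmf_bind[OF assms(1), of False "\<lambda>_. ?B p'" "\<lambda>x b. return_pmf (c x \<or> b)" False]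
    unfolding map_pmf_def Pi_pmf_return_pmf[OF assms(1)] .
  have 3: "map_pmf (\<lambda>c. {x \<in> X. c x}) (map_pmf (\<lambda>c' x. if x \<in> X then c x \<or> c' x else False) (?P p'))
      = map_pmf (\<lambda>c'. {x \<in> X. c x} \<union> {x \<in> X. c' x}) (?P p')" for c
    unfolding pmf.map_comp by (rule arg_cong[of _ _ "\<lambda>f. map_pmf f (?P p')"]) (auto simp: fun_eq_iff)
  show ?thesis
    unfolding random_subset_def 1 2 map_bind_pmf 3 bind_map_pmf by (simp add: pmf.map_comp o_def)
qed

section \<open>Minimal fragments and spread families\<close>

definition minimal_fragments :: "'a set set \<Rightarrow> 'a set \<Rightarrow> 'a set set" where
  "minimal_fragments H W = {T \<in> (\<lambda>S. S - W) ` H. \<forall>S\<in>H. S - W \<subseteq> T \<longrightarrow> S - W = T}"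

text \<open>Every trace of a finite family lies above a minimal one. Hence a family covering the
  minimal fragments also covers \<open>H\<close>.\<close>

lemma minimal_fragments_below:
  assumes "finite X" "H \<subseteq> Pow X" "S \<in> H"
  obtains T where "T \<in> minimal_fragments H W" "T \<subseteq> S"
proof -
  have "finite ((\<lambda>S. S - W) ` H)"
    using assms by (meson finite_Pow_iff finite_imageI finite_subset)
  from finite_has_minimal2[OF this, of "S - W"] assms(3)
  obtain T where "T \<in> (\<lambda>S. S - W) ` H" "T \<subseteq> S - W" "\<forall>b\<in>(\<lambda>S. S - W) ` H. b \<subseteq> T \<longrightarrow> T = b"
    by blast
  then have "T \<in> minimal_fragments H W" "T \<subseteq> S"
    unfolding minimal_fragments_def by auto
  then show ?thesis by (rule that)
qed

lemma minimal_fragments_subset: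
  assumes "H \<subseteq> Pow X" "T \<in> minimal_fragments H W"
  shows "T \<subseteq> X" "T \<inter> W = {}"
  using assms unfolding minimal_fragments_def by auto

text \<open>Knowing only \<open>W \<union> T\<close>, any member of \<open>H\<close> inside it must contain the fragment \<open>T\<close>.
  So there are few candidates for \<open>T\<close>.\<close>

lemma minimal_fragment_subset_any:
  assumes "T \<in> minimal_fragments H W" "S \<in> H" "S \<subseteq> W \<union> T"
  shows "T \<subseteq> S"
  using assms unfolding minimal_fragments_def by blast

text \<open>Double counting: a pair \<open>(W, T)\<close> is charged to \<open>(Z, T)\<close> with
  \<open>Z = W \<union> T\<close>. With \<open>t = card T\<close>, the change of measure replaces
  \<open>q ^ t\<close> by at most \<open>(y / 4) ^ t\<close>. Each \<open>Z\<close> has at most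
  \<open>2 ^ l\<close> candidates for \<open>T\<close>, which \<open>4 ^ t\<close> absorbs because
  \<open>2 * t > l\<close>. What remains is \<open>y ^ t\<close>, and \<open>t\<close> is at least
  \<open>l div 2 + 1\<close>.\<close>

lemma large_fragments_cost:
  fixes p q y :: real
  assumes X: "finite X" and H: "H \<subseteq> Pow X" and l: "\<And>S. S \<in> H \<Longrightarrow> card S \<le> l"
    and p: "0 < p" "p \<le> 1" and q: "0 \<le> q" "4 * q \<le> y * p" and y: "0 \<le> y" "y \<le> 1"
  shows "(\<Sum>W\<in>Pow X. pmf (random_subset X p) W *
           (\<Sum>T | T \<in> minimal_fragments H W \<and> l < 2 * card T. q ^ card T)) \<le> y ^ (l div 2 + 1)"
proof -
  define \<mu> where "\<mu> = pmf (random_subset X p)"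
  define F where "F W = {T. T \<in> minimal_fragments H W \<and> l < 2 * card T}" for W
  \<comment> \<open>The candidates depend on \<open>Z\<close> alone: they are the subsets of one
    chosen member of \<open>H\<close> inside \<open>Z\<close>.\<close>
  define G where "G Z = (if \<exists>S\<in>H. S \<subseteq> Z then Pow (SOME S. S \<in> H \<and> S \<subseteq> Z) else {})" for Z
  define c where "c = y ^ (l div 2 + 1) / 2 ^ l"
  have c: "0 \<le> c" using y by (simp add: c_def)
  have FX: "T \<subseteq> X" "T \<inter> W = {}" if "T \<in> F W" for T W
    using that minimal_fragments_subset[OF H] unfolding F_def by blast+
  then have finF: "finite (F W)" for W
    using X by (meson Pow_iff finite_Pow_iff finite_subset subsetI)
  have G: "finite (G Z)" "card (G Z) \<le> 2 ^ l" for Z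
  proof -
    let ?S = "SOME S. S \<in> H \<and> S \<subseteq> Z"
    have "?S \<in> H" if "\<exists>S\<in>H. S \<subseteq> Z"
      using someI_ex[of "\<lambda>S. S \<in> H \<and> S \<subseteq> Z"] that by blast
    then have "finite ?S \<and> card ?S \<le> l" if "\<exists>S\<in>H. S \<subseteq> Z"
      using that l H X by (meson Pow_iff finite_subset subsetD)
    then show "finite (G Z)" "card (G Z) \<le> 2 ^ l"
      unfolding G_def by (auto simp: card_Pow power_increasing)
  qed
  have FG: "T \<in> G (W \<union> T)" if "T \<in> F W" for W T
  proof -
    obtain S where "S \<in> H" "T = S - W"
      using \<open>T \<in> F W\<close> unfolding F_def minimal_fragments_def by blast
    then have ex: "\<exists>S\<in>H. S \<subseteq> W \<union> T" by blast
    then have "(SOME S. S \<in> H \<and> S \<subseteq> W \<union> T) \<in> H \<and> (SOME S. S \<in> H \<and> S \<subseteq> W \<union> T) \<subseteq> W \<union> T"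
      using someI_ex[of "\<lambda>S. S \<in> H \<and> S \<subseteq> W \<union> T"] by blast
    then show ?thesis
      using that ex minimal_fragment_subset_any[of T H W] unfolding F_def G_def by auto
  qed
  have weight: "\<mu> W * q ^ card T \<le> c * \<mu> (W \<union> T)" if "W \<subseteq> X" "T \<in> F W" for W T
  proof -
    let ?t = "card T"
    have t: "l < 2 * ?t" using that by (simp add: F_def)
    then have "l div 2 + 1 \<le> ?t" by linarith
    then have "y ^ ?t \<le> y ^ (l div 2 + 1)" using y by (rule power_decreasing)
    moreover have "(2::real) ^ l \<le> 4 ^ ?t"
    proof -
      have "(2::real) ^ l \<le> 2 ^ (2 * ?t)" using t by (intro power_increasing) auto
      then show ?thesis by (simp add: power_mult)
    qed
    ultimately have le: "y ^ ?t / 4 ^ ?t \<le> c"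
      unfolding c_def using y by (intro frac_le) auto
    have "q ^ ?t \<le> (y * p / 4) ^ ?t" using q by (intro power_mono) auto
    also have "\<dots> = y ^ ?t / 4 ^ ?t * p ^ ?t" by (simp add: power_divide power_mult_distrib)
    also have "\<dots> \<le> c * p ^ ?t" using le p by (intro mult_right_mono) auto
    finally have "\<mu> W * q ^ ?t \<le> \<mu> W * (c * p ^ ?t)"
      by (intro mult_left_mono) (auto simp: \<mu>_def)
    also have "\<dots> = c * (\<mu> W * p ^ ?t)" by simp
    also have "\<dots> \<le> c * \<mu> (W \<union> T)"
      using pmf_random_subset_disjoint_Un[OF X that(1) FX(1)[OF that(2)]] FX(2)[OF that(2)] p c
      unfolding \<mu>_def by (intro mult_left_mono) (auto simp: Int_commute)
    finally show ?thesis .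
  qed
  let ?\<Sigma> = "Sigma (Pow X) F"
  have "(\<Sum>W\<in>Pow X. \<mu> W * (\<Sum>T\<in>F W. q ^ card T)) = (\<Sum>(W, T)\<in>?\<Sigma>. \<mu> W * q ^ card T)"
    using X finF by (simp add: sum_distrib_left sum.Sigma)
  also have "\<dots> \<le> (\<Sum>(W, T)\<in>?\<Sigma>. c * \<mu> (W \<union> T))"
    using weight by (intro sum_mono) auto
  \<comment> \<open>No pair is lost: \<open>W\<close> is recovered as \<open>Z - T\<close>, since
    fragments are disjoint from \<open>W\<close>.\<close>
  also have "\<dots> = (\<Sum>(Z, T)\<in>(\<lambda>(W, T). (W \<union> T, T)) ` ?\<Sigma>. c * \<mu> Z)"
  proof (subst sum.reindex)
    show "inj_on (\<lambda>(W, T). (W \<union> T, T)) ?\<Sigma>"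
    proof (rule inj_onI)
      fix a b
      assume *: "a \<in> ?\<Sigma>" "b \<in> ?\<Sigma>" "(\<lambda>(W, T). (W \<union> T, T)) a = (\<lambda>(W, T). (W \<union> T, T)) b"
      then have "fst a = fst b"
        using FX(2)[of "snd a" "fst a"] FX(2)[of "snd b" "fst b"] by (clarsimp, blast)
      with * show "a = b" by (auto simp: prod_eq_iff split_beta)
    qed
  qed (auto intro!: sum.cong)
  also have "\<dots> \<le> (\<Sum>(Z, T)\<in>Sigma (Pow X) G. c * \<mu> Z)"
  proof (rule sum_mono2)
    show "(\<lambda>(W, T). (W \<union> T, T)) ` ?\<Sigma> \<subseteq> Sigma (Pow X) G"
    proof (rule image_subsetI)
      fix a assume "a \<in> ?\<Sigma>"
      then show "(\<lambda>(W, T). (W \<union> T, T)) a \<in> Sigma (Pow X) G"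
        using FG[of "snd a" "fst a"] FX(1)[of "snd a" "fst a"] by auto
    qed
  qed (use X G(1) c in \<open>auto simp: \<mu>_def\<close>)
  also have "\<dots> = (\<Sum>Z\<in>Pow X. \<Sum>T\<in>G Z. c * \<mu> Z)"
    using X G(1) by (subst sum.Sigma) auto
  also have "\<dots> = (\<Sum>Z\<in>Pow X. \<mu> Z * (c * card (G Z)))"
    by (simp add: mult_ac)
  also have "\<dots> \<le> (\<Sum>Z\<in>Pow X. \<mu> Z * y ^ (l div 2 + 1))"
  proof (intro sum_mono mult_left_mono)
    fix Z
    have "real (card (G Z)) \<le> 2 ^ l" using G(2)[of Z] by (metis of_nat_le_iff of_nat_numeral of_nat_power)
    then have "c * card (G Z) \<le> c * 2 ^ l" using c by (rule mult_left_mono)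
    then show "c * card (G Z) \<le> y ^ (l div 2 + 1)" by (simp add: c_def)
  qed (simp add: \<mu>_def)
  also have "\<dots> = y ^ (l div 2 + 1)"
    unfolding \<mu>_def sum_distrib_right[symmetric] sum_pmf_random_subset[OF X] by simp
  finally show ?thesis unfolding \<mu>_def F_def .
qed

section \<open>Containment probabilities and repeated rounds\<close>

definition containment_prob :: "'a set \<Rightarrow> real \<Rightarrow> 'a set set \<Rightarrow> real" where
  "containment_prob X p H = measure_pmf.prob (random_subset X p) {W. \<exists>S\<in>H. S \<subseteq> W}"

text \<open>The target family \<open>H' W\<close> of the second round may depend on the outcome
  \<open>W\<close> of the first. Once a second round catches a member of \<open>H' W\<close>, the
  union of both rounds contains a member of \<open>H\<close>.\<close>

lemma containment_prob_combine:
  assumes "finite X" "0 \<le> p" "p \<le> 1" "0 \<le> p'" "p' \<le> 1"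
    and "\<And>W T. W \<subseteq> X \<Longrightarrow> T \<in> H' W \<Longrightarrow> \<exists>S\<in>H. S \<subseteq> W \<union> T"
  shows "(\<Sum>W\<in>Pow X. pmf (random_subset X p) W * containment_prob X p' (H' W))
         \<le> containment_prob X (1 - (1 - p) * (1 - p')) H"
proof -
  have "containment_prob X (1 - (1 - p) * (1 - p')) H = (\<Sum>W\<in>Pow X. pmf (random_subset X p) W *
      measure_pmf.prob (random_subset X p') {W'. \<exists>S\<in>H. S \<subseteq> W \<union> W'})"
    unfolding containment_prob_def random_subset_Un[OF assms(1-5)] prob_bind_pmf
      expectation_random_subset[OF assms(1)] by (simp add: vimage_def)
  moreover have "containment_prob X p' (H' W)
      \<le> measure_pmf.prob (random_subset X p') {W'. \<exists>S\<in>H. S \<subseteq> W \<union> W'}" if "W \<subseteq> X" for W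
    unfolding containment_prob_def
  proof (rule measure_pmf.finite_measure_mono)
    show "{Wa. \<exists>S\<in>H' W. S \<subseteq> Wa} \<subseteq> {W'. \<exists>S\<in>H. S \<subseteq> W \<union> W'}"
      using assms(6)[OF that] by (clarsimp, metis Un_mono order_refl order_trans)
  qed simp
  ultimately show ?thesis
    by (auto intro!: sum_mono mult_left_mono)
qed

lemma containment_prob_mono:
  assumes "finite X" "0 \<le> p" "p \<le> p'" "p' \<le> 1"
  shows "containment_prob X p H \<le> containment_prob X p' H"
proof (cases "p = p'")
  case False
  \<comment> \<open>An extra round of density \<open>r\<close> raises the density from
    \<open>p\<close> to \<open>p'\<close>. The divisor is nonzero, since \<open>p = 1\<close> would
    force \<open>p' = p\<close>.\<close>
  define r where "r = (p' - p) / (1 - p)"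
  have r: "0 \<le> r" "r \<le> 1" "1 - (1 - r) * (1 - p) = p'"
    using assms False by (auto simp: r_def field_simps)
  have "(\<Sum>W\<in>Pow X. pmf (random_subset X r) W * containment_prob X p H)
         \<le> containment_prob X (1 - (1 - r) * (1 - p)) H"
    using assms r(1,2) by (intro containment_prob_combine) auto
  then show ?thesis
    using r(3) by (simp add: sum_distrib_right[symmetric] sum_pmf_random_subset assms(1))
qed simp

text \<open>Base of the halving. \<open>H\<close> is empty or consists of the empty set, and covers
  itself; its cost is 0 or 1, which is exactly its containment probability.\<close>

lemma exists_cover_card_0:
  fixes q y :: real
  assumes "finite X" "H \<subseteq> Pow X" "\<And>S. S \<in> H \<Longrightarrow> card S \<le> l" "l = 0"
  shows "\<exists>U \<subseteq> Pow X. (\<forall>S\<in>H. \<exists>T\<in>U. T \<subseteq> S) \<and>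
      (\<Sum>T\<in>U. q ^ card T) \<le> containment_prob X r H + (\<Sum>t=1..l. y ^ t)"
proof (intro exI[of _ H] conjI)
  have "S = {}" if "S \<in> H" for S
    using assms(2) assms(3)[OF that] assms(4) that finite_subset[OF _ assms(1), of S] by auto
  then have "H \<subseteq> {{}}" by blast
  then consider "H = {}" | "H = {{}}" by blast
  then show "(\<Sum>T\<in>H. q ^ card T) \<le> containment_prob X r H + (\<Sum>t=1..l. y ^ t)"
    by cases (auto simp: containment_prob_def assms(4))
qed (use assms in auto)

text \<open>Induction on the number \<open>m\<close> of rounds. After one round \<open>W\<close>,
  the large fragments join the cover outright, and the small ones, of size at most
  \<open>l div 2\<close>, are covered by induction. The expected total cost obeys the bound, so some
  fixed \<open>W\<close> does too. The condition \<open>l < 2 ^ m\<close> ensures that the halvings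
  reach 0.\<close>

lemma exists_cheap_cover:
  fixes p q y :: real
  assumes X: "finite X" and p: "0 < p" "p \<le> 1" and q: "0 \<le> q" "4 * q \<le> y * p"
    and y: "0 \<le> y" "y \<le> 1"
  shows "H \<subseteq> Pow X \<Longrightarrow> (\<And>S. S \<in> H \<Longrightarrow> card S \<le> l) \<Longrightarrow> l < 2 ^ m \<Longrightarrow>
    \<exists>U \<subseteq> Pow X. (\<forall>S\<in>H. \<exists>T\<in>U. T \<subseteq> S) \<and>
      (\<Sum>T\<in>U. q ^ card T) \<le> containment_prob X (1 - (1 - p) ^ m) H + (\<Sum>t=1..l. y ^ t)"
proof (induction m arbitrary: l H)
  case 0
  then show ?case using X by (intro exists_cover_card_0) auto
next
  case (Suc m)
  show ?case
  proof (cases "l = 0")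
    case True
    then show ?thesis using Suc X by (intro exists_cover_card_0) auto
  next
    case False
    let ?\<mu> = "pmf (random_subset X p)" and ?l = "l div 2"
    \<comment> \<open>\<open>?r\<close> is the joint density of the \<open>m\<close> remaining
      rounds, and \<open>?\<delta>\<close> is their share of the error.\<close>
    let ?r = "1 - (1 - p) ^ m" and ?\<delta> = "\<Sum>t=1..l div 2. y ^ t"
    define L where "L W = {T. T \<in> minimal_fragments H W \<and> l < 2 * card T}" for W
    define R where "R W = {T. T \<in> minimal_fragments H W \<and> \<not> l < 2 * card T}" for W
    have LX: "L W \<subseteq> Pow X" and RX: "R W \<subseteq> Pow X" for W
      using minimal_fragments_subset(1)[OF Suc.prems(1)] unfolding L_def R_def by blast+
    have "\<exists>U \<subseteq> Pow X. (\<forall>S\<in>R W. \<exists>T\<in>U. T \<subseteq> S) \<and>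
        (\<Sum>T\<in>U. q ^ card T) \<le> containment_prob X ?r (R W) + ?\<delta>" for W
      using Suc.prems(3) RX by (intro Suc.IH) (auto simp: R_def)
    then obtain U where U: "\<And>W. U W \<subseteq> Pow X" "\<And>W S. S \<in> R W \<Longrightarrow> \<exists>T\<in>U W. T \<subseteq> S"
        "\<And>W. (\<Sum>T\<in>U W. q ^ card T) \<le> containment_prob X ?r (R W) + ?\<delta>"
      by metis
    define f where "f W = (\<Sum>T\<in>L W \<union> U W. q ^ card T)" for W
    let ?B = "containment_prob X (1 - (1 - p) ^ Suc m) H + (\<Sum>t=1..l. y ^ t)"
    have r: "0 \<le> ?r" "?r \<le> 1" using p by (auto simp: power_le_one)
    have "(\<Sum>W\<in>Pow X. ?\<mu> W * f W) \<le> ?B"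
    proof -
      have fin: "finite (L W)" "finite (U W)" for W
        using LX U(1) X by (meson finite_Pow_iff finite_subset)+
      have f_le: "f W \<le> (\<Sum>T\<in>L W. q ^ card T) + (containment_prob X ?r (R W) + ?\<delta>)" for W
      proof -
        have "f W \<le> (\<Sum>T\<in>L W. q ^ card T) + (\<Sum>T\<in>U W. q ^ card T)"
          unfolding f_def using fin q(1) by (subst sum_Un) (auto intro!: sum_nonneg)
        with U(3)[of W] show ?thesis by linarith
      qed
      have "(\<Sum>W\<in>Pow X. ?\<mu> W * f W) \<le> (\<Sum>W\<in>Pow X. ?\<mu> W *
          ((\<Sum>T\<in>L W. q ^ card T) + (containment_prob X ?r (R W) + ?\<delta>)))"
        by (intro sum_mono mult_left_mono f_le) auto
      also have "\<dots> = (\<Sum>W\<in>Pow X. ?\<mu> W * (\<Sum>T\<in>L W. q ^ card T)) +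
          ((\<Sum>W\<in>Pow X. ?\<mu> W * containment_prob X ?r (R W)) + (\<Sum>W\<in>Pow X. ?\<mu> W) * ?\<delta>)"
        by (simp add: distrib_left sum.distrib sum_distrib_right)
      also have "\<dots> \<le> y ^ (?l + 1) + (containment_prob X (1 - (1 - p) * (1 - ?r)) H + ?\<delta>)"
      proof (intro add_mono)
        show "(\<Sum>W\<in>Pow X. ?\<mu> W * (\<Sum>T\<in>L W. q ^ card T)) \<le> y ^ (?l + 1)"
          unfolding L_def by (rule large_fragments_cost[OF X Suc.prems(1,2) p q y])
        show "(\<Sum>W\<in>Pow X. ?\<mu> W * containment_prob X ?r (R W))
            \<le> containment_prob X (1 - (1 - p) * (1 - ?r)) H"
          using X p r
          by (intro containment_prob_combine) (auto simp: R_def minimal_fragments_def)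
      qed (simp add: sum_pmf_random_subset[OF X])
      also have "y ^ (?l + 1) + ?\<delta> = (\<Sum>t=1..?l + 1. y ^ t)" by simp
      then have "y ^ (?l + 1) + (containment_prob X (1 - (1 - p) * (1 - ?r)) H + ?\<delta>)
          = containment_prob X (1 - (1 - p) ^ Suc m) H + (\<Sum>t=1..?l + 1. y ^ t)" by simp
      \<comment> \<open>The exponent \<open>l div 2 + 1\<close> contributed by this round is new to
        the sum and, as \<open>l\<close> is positive, at most \<open>l\<close>.\<close>
      also have "(\<Sum>t=1..?l + 1. y ^ t) \<le> (\<Sum>t=1..l. y ^ t)"
        using False y(1) by (intro sum_mono2) auto
      finally show ?thesis by simp
    qed
    \<comment> \<open>First-moment argument: if all costs exceeded \<open>?B\<close>, so would their
      mean, strictly so because some \<open>W\<close> has positive weight.\<close>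
    have "\<exists>W\<in>Pow X. f W \<le> ?B"
    proof (rule ccontr)
      assume "\<not> ?thesis"
      then have *: "\<forall>W\<in>Pow X. ?B < f W" by (meson not_le)
      obtain W\<^sub>0 where W0: "W\<^sub>0 \<in> Pow X" "?\<mu> W\<^sub>0 > 0"
        using set_pmf_random_subset[of X p] set_pmf_not_empty[of "random_subset X p"]
        by (metis ex_in_conv pmf_positive subsetD)
      have "(\<Sum>W\<in>Pow X. ?\<mu> W * ?B) < (\<Sum>W\<in>Pow X. ?\<mu> W * f W)"
      proof (rule sum_strict_mono_ex1)
        show "\<forall>W\<in>Pow X. ?\<mu> W * ?B \<le> ?\<mu> W * f W"
          using * by (intro ballI mult_left_mono) (auto intro: less_imp_le)
        show "\<exists>W\<in>Pow X. ?\<mu> W * ?B < ?\<mu> W * f W"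
          using * W0 by (intro bexI[of _ W\<^sub>0] mult_strict_left_mono) auto
      qed (use X in auto)
      moreover have "(\<Sum>W\<in>Pow X. ?\<mu> W * ?B) = ?B"
        unfolding sum_distrib_right[symmetric] sum_pmf_random_subset[OF X] by simp
      ultimately show False using \<open>(\<Sum>W\<in>Pow X. ?\<mu> W * f W) \<le> ?B\<close> by linarith
    qed
    then obtain W where W: "W \<subseteq> X" "f W \<le> ?B" by auto
    have "\<forall>S\<in>H. \<exists>T\<in>L W \<union> U W. T \<subseteq> S"
    proof
      fix S assume "S \<in> H"
      from minimal_fragments_below[OF X Suc.prems(1) this, of W]
      obtain T where T: "T \<in> minimal_fragments H W" "T \<subseteq> S" .
      then consider "T \<in> L W" | "T \<in> R W" unfolding L_def R_def by blast
      then show "\<exists>T\<in>L W \<union> U W. T \<subseteq> S"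
        using T(2) U(2) by cases (blast, metis Un_iff order_trans)
    qed
    then show ?thesis
      using W(2) LX U(1) unfolding f_def by (intro exI[of _ "L W \<union> U W"]) auto
  qed
qed

text \<open>By the union bound, spreadness forces every cover of the sets \<open>C w\<close> to cost
  at least 1. The cover from \<open>exists_cheap_cover\<close> costs at most the containment
  probability plus a geometric sum below \<open>2 * y\<close>, so that probability must be
  large.\<close>

lemma spread_containment:
  fixes p q y :: real and C :: "'w \<Rightarrow> 'a set"
  assumes X: "finite X" and \<Omega>: "finite \<Omega>" "\<Omega> \<noteq> {}"
    and C: "\<And>w. w \<in> \<Omega> \<Longrightarrow> C w \<subseteq> X" "\<And>w. w \<in> \<Omega> \<Longrightarrow> card (C w) \<le> l"
    and spread: "\<And>T. T \<subseteq> X \<Longrightarrow> card {w \<in> \<Omega>. T \<subseteq> C w} \<le> q ^ card T * card \<Omega>"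
    and p: "0 < p" "p \<le> 1" and q: "0 \<le> q" "4 * q \<le> y * p"
    and y: "0 \<le> y" "y \<le> 1 / 2" and m: "l < 2 ^ m" "m * p \<le> p'" "p' \<le> 1"
  shows "containment_prob X p' (C ` \<Omega>) \<ge> 1 - 2 * y"
proof -
  have "\<exists>U \<subseteq> Pow X. (\<forall>S\<in>C ` \<Omega>. \<exists>T\<in>U. T \<subseteq> S) \<and>
      (\<Sum>T\<in>U. q ^ card T) \<le> containment_prob X (1 - (1 - p) ^ m) (C ` \<Omega>) + (\<Sum>t=1..l. y ^ t)"
    using C y m by (intro exists_cheap_cover[OF X p q]) auto
  then obtain U where U: "U \<subseteq> Pow X" "\<And>w. w \<in> \<Omega> \<Longrightarrow> \<exists>T\<in>U. T \<subseteq> C w"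
     "(\<Sum>T\<in>U. q ^ card T) \<le> containment_prob X (1 - (1 - p) ^ m) (C ` \<Omega>) + (\<Sum>t=1..l. y ^ t)"
    by auto
  have finU: "finite U" using U(1) X by (meson finite_Pow_iff finite_subset)
  have "real (card \<Omega>) \<le> real (card (\<Union>T\<in>U. {w \<in> \<Omega>. T \<subseteq> C w}))"
    using U(2) finU \<Omega>(1) by (intro of_nat_mono card_mono) auto
  also have "\<dots> \<le> (\<Sum>T\<in>U. real (card {w \<in> \<Omega>. T \<subseteq> C w}))"
    using card_UN_le[OF finU] by (simp flip: of_nat_sum)
  also have "\<dots> \<le> (\<Sum>T\<in>U. q ^ card T * card \<Omega>)"
    using spread U(1) by (intro sum_mono) auto
  finally have "real (card \<Omega>) * 1 \<le> real (card \<Omega>) * (\<Sum>T\<in>U. q ^ card T)"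
    by (simp add: sum_distrib_left mult.commute)
  moreover have "0 < real (card \<Omega>)" using \<Omega> by (simp add: card_gt_0_iff)
  ultimately have "1 \<le> (\<Sum>T\<in>U. q ^ card T)"
    by (rule mult_left_le_imp_le)
  moreover have "(\<Sum>t=1..l. y ^ t) \<le> 2 * y"
  proof -
    have "(\<Sum>t=1..l. y ^ t) \<le> y / (1 - y)"
      using sum_gp[of y 1 l] y by (auto simp: divide_right_mono)
    also have "\<dots> \<le> 2 * y" using y mult_left_mono[of y "1/2" y] by (simp add: field_simps)
    finally show ?thesis .
  qed
  moreover have "containment_prob X (1 - (1 - p) ^ m) (C ` \<Omega>) \<le> containment_prob X p' (C ` \<Omega>)"
  proof (rule containment_prob_mono[OF X])
    show "0 \<le> 1 - (1 - p) ^ m" using p by (simp add: power_le_one)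
    \<comment> \<open>Bernoulli's inequality bounds the density of the union of \<open>m\<close>
      rounds by \<open>m * p\<close>.\<close>
    show "1 - (1 - p) ^ m \<le> p'"
      using Bernoulli_inequality[of "- p" m] p m(2) by simp
  qed (use m in auto)
  ultimately show ?thesis using U(3) by linarith
qed

section \<open>Counting cyclic orders with prescribed successors\<close>

text \<open>Describes a cyclic order cut open into a word, with successors on \<open>S\<close>
  prescribed by \<open>s\<close>. Letters in the image of \<open>S\<close> may follow only members
  of \<open>S\<close>; this converse condition makes them redundant when the word is encoded. A
  final letter in \<open>S\<close> is excluded because its successor would be missing.\<close>

fun chained :: "'a set \<Rightarrow> ('a \<Rightarrow> 'a) \<Rightarrow> 'a list \<Rightarrow> bool" where
  "chained S s [] = True"
| "chained S s [x] = (x \<notin> S)"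
| "chained S s (x # y # xs) = ((if x \<in> S then y = s x else y \<notin> s ` S) \<and> chained S s (y # xs))"

lemma chainedI:
  assumes "\<And>i. i < length xs \<Longrightarrow> xs ! i \<in> S \<Longrightarrow> Suc i < length xs \<and> xs ! Suc i = s (xs ! i)"
    and "\<And>i. Suc i < length xs \<Longrightarrow> xs ! i \<notin> S \<Longrightarrow> xs ! Suc i \<notin> s ` S"
  shows "chained S s xs"
  using assms
proof (induction S s xs rule: chained.induct)
  case (2 S s x)
  then show ?case by force
next
  case (3 S s x y xs)
  have "chained S s (y # xs)"
  proof (rule "3.IH")
    fix i assume "i < length (y # xs)" "(y # xs) ! i \<in> S"
    then show "Suc i < length (y # xs) \<and> (y # xs) ! Suc i = s ((y # xs) ! i)"
      using "3.prems"(1)[of "Suc i"] by simp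
  next
    fix i assume "Suc i < length (y # xs)" "(y # xs) ! i \<notin> S"
    then show "(y # xs) ! Suc i \<notin> s ` S"
      using "3.prems"(2)[of "Suc i"] by simp
  qed
  moreover have "if x \<in> S then y = s x else y \<notin> s ` S"
    using "3.prems"(1)[of 0] "3.prems"(2)[of 0] by auto
  ultimately show ?case by simp
qed auto

text \<open>The deleted letters are forced by their predecessors. So the word can be rebuilt from
  the left: after a member of \<open>S\<close> comes its prescribed successor, otherwise the next
  surviving letter.\<close>

lemma chained_filter_inj:
  assumes "chained S s (x # xs)" "chained S s (x # ys)"
    and "filter (\<lambda>z. z \<notin> s ` S) xs = filter (\<lambda>z. z \<notin> s ` S) ys"
  shows "xs = ys"
  using assms
proof (induction xs arbitrary: x ys)
  case Nil
  show ?case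
  proof (cases ys)
    case (Cons z zs)
    have "z \<in> s ` S" using Nil(3) Cons by (metis filter.simps list.distinct(1))
    then have "x \<in> S" using Nil(2) Cons by (auto split: if_splits)
    with Nil(1) show ?thesis by simp
  qed simp
next
  case (Cons y xs)
  note IH = Cons.IH and prems = Cons.prems
  show ?case
  proof (cases ys)
    case Nil
    have "y \<in> s ` S" using prems(3) Nil by (metis filter.simps list.distinct(1))
    then have "x \<in> S" using prems(1) by (auto split: if_splits)
    with prems(2) Nil show ?thesis by simp
  next
    case (Cons z zs)
    have "y = z"
    proof (cases "x \<in> S")
      case True
      then show ?thesis using prems(1,2) Cons by simp
    next
      case False
      then have "y \<notin> s ` S" "z \<notin> s ` S" using prems(1,2) Cons by auto
      then show ?thesis using prems(3) Cons by simp
    qed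
    moreover have "xs = zs"
      using IH[of y zs] prems Cons \<open>y = z\<close> by (auto split: if_splits)
    ultimately show ?thesis using Cons by simp
  qed
qed

section \<open>Reading a cyclic order from a fixed letter\<close>

lemma rotate_index_inj:
  fixes i j i\<^sub>0 m :: nat
  assumes "i < m" "j < m" "(i\<^sub>0 + i) mod m = (i\<^sub>0 + j) mod m"
  shows "i = j"
proof -
  have *: "i = j" if "i < m" "j < m" "(i\<^sub>0 + i) mod m = (i\<^sub>0 + j) mod m" "j \<le> i" for i j
  proof -
    have "m dvd i - j"
      using that mod_eq_dvd_iff_nat[of "i\<^sub>0 + j" "i\<^sub>0 + i" m] by simp
    then show ?thesis using that by (auto dest: dvd_imp_le)
  qed
  show ?thesis using *[of i j] *[of j i] assms by linarith
qed

lemma Suc_mod_inj: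
  fixes i j m :: nat
  assumes "i < m" "j < m" "Suc i mod m = Suc j mod m"
  shows "i = j"
  using assms rotate_index_inj[of i m j 1] by simp

text \<open>Cut the cyclic order at a letter \<open>r\<close> that is nobody's prescribed successor.
  The position of \<open>r\<close> gives \<open>m\<close> choices; the order of the
  \<open>m - 1 - card S\<close> other unforced letters then determines everything.\<close>

lemma card_cyclic_orders_aux:
  assumes S: "S \<subseteq> {..<m}" "s ` S \<subseteq> {..<m}" "inj_on s S" and m: "card S < m"
  shows "card {\<pi>. \<pi> permutes {..<m} \<and> (\<forall>i<m. \<pi> i \<in> S \<longrightarrow> \<pi> (Suc i mod m) = s (\<pi> i))}
         \<le> m * fact (m - 1 - card S)"
    (is "card ?G \<le> _")
proof -
  have finS: "finite S" using S(1) finite_subset by blast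
  have cs: "card (s ` S) = card S" by (rule card_image[OF S(3)])
  obtain r where r: "r < m" "r \<notin> s ` S"
  proof -
    have "\<not> {..<m} \<subseteq> s ` S"
      using card_mono[of "s ` S" "{..<m}"] finS cs m by auto
    then show ?thesis using that by auto
  qed
  define L where "L \<pi> = map (\<lambda>i. \<pi> ((inv \<pi> r + i) mod m)) [0..<m]" for \<pi> :: "nat \<Rightarrow> nat"
  define \<Phi> where "\<Phi> \<pi> = (inv \<pi> r, filter (\<lambda>z. z \<notin> s ` S) (tl (L \<pi>)))" for \<pi>
  have len: "length (L \<pi>) = m" and nth: "i < m \<Longrightarrow> L \<pi> ! i = \<pi> ((inv \<pi> r + i) mod m)" for \<pi> i
    by (auto simp: L_def)
  have L: "inv \<pi> r < m" "L \<pi> = r # tl (L \<pi>)" "distinct (L \<pi>)" "set (L \<pi>) = {..<m}" "chained S s (L \<pi>)"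
    if "\<pi> \<in> ?G" for \<pi>
  proof -
    have p: "\<pi> permutes {..<m}" and succ: "\<And>i. i < m \<Longrightarrow> \<pi> i \<in> S \<Longrightarrow> \<pi> (Suc i mod m) = s (\<pi> i)"
      using that by auto
    have inj: "inj \<pi>" using p by (rule permutes_inj)
    show i0: "inv \<pi> r < m"
      using permutes_in_image[OF permutes_inv[OF p], of r] r(1) by simp
    have "L \<pi> ! 0 = r"
      using nth[of 0 \<pi>] i0 r(1) permutes_inverses(1)[OF p] by simp
    then show hd: "L \<pi> = r # tl (L \<pi>)"
      using len[of \<pi>] r(1) by (cases "L \<pi>") auto
    show dist: "distinct (L \<pi>)"
      unfolding L_def distinct_map
    proof (intro conjI inj_onI)
      fix i j
      assume "i \<in> set [0..<m]" "j \<in> set [0..<m]" "\<pi> ((inv \<pi> r + i) mod m) = \<pi> ((inv \<pi> r + j) mod m)"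
      then show "i = j" using rotate_index_inj[of i m j "inv \<pi> r"] injD[OF inj] by auto
    qed simp
    have "set (L \<pi>) \<subseteq> {..<m}"
    proof
      fix x assume "x \<in> set (L \<pi>)"
      then obtain i where "x = \<pi> ((inv \<pi> r + i) mod m)" unfolding L_def by auto
      then show "x \<in> {..<m}"
        using permutes_in_image[OF p, of "(inv \<pi> r + i) mod m"] r(1) by simp
    qed
    then show "set (L \<pi>) = {..<m}"
      using distinct_card[OF dist] len by (intro card_subset_eq) auto
    show "chained S s (L \<pi>)"
    proof (rule chainedI)
      fix i assume i: "i < length (L \<pi>)" "L \<pi> ! i \<in> S"
      let ?j = "(inv \<pi> r + i) mod m"
      have j: "?j < m" "\<pi> ?j \<in> S" using i r(1) by (auto simp: len nth)
      have nxt: "\<pi> ((inv \<pi> r + Suc i) mod m) = s (\<pi> ?j)"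
        using succ[OF j] by (simp add: mod_Suc_eq)
      \<comment> \<open>A last letter in \<open>S\<close> would have \<open>r\<close> as its
        prescribed successor, against the choice of \<open>r\<close>.\<close>
      have "Suc i \<noteq> m"
      proof
        assume "Suc i = m"
        then have "s (\<pi> ?j) = r"
          using nxt i0 permutes_inverses(1)[OF p] by simp
        then show False using r(2) imageI[OF j(2), of s] by simp
      qed
      then show "Suc i < length (L \<pi>) \<and> L \<pi> ! Suc i = s (L \<pi> ! i)"
        using i nxt by (simp add: len nth)
    next
      fix i assume i: "Suc i < length (L \<pi>)" "L \<pi> ! i \<notin> S"
      show "L \<pi> ! Suc i \<notin> s ` S"
      proof
        assume "L \<pi> ! Suc i \<in> s ` S"
        then obtain a where a: "a \<in> S" "L \<pi> ! Suc i = s a" by blast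
        \<comment> \<open>The prescribed predecessor \<open>a\<close> must be the actual one,
          because each position has a unique predecessor modulo \<open>m\<close>.\<close>
        define j where "j = inv \<pi> a"
        have j: "j < m" "\<pi> j = a"
          using permutes_in_image[OF permutes_inv[OF p], of a] a(1) S(1)
            permutes_inverses(1)[OF p] by (auto simp: j_def)
        have "\<pi> (Suc j mod m) = \<pi> (Suc ((inv \<pi> r + i) mod m) mod m)"
          using succ[OF j(1)] j(2) a i(1) by (simp add: nth len mod_Suc_eq)
        then have "Suc j mod m = Suc ((inv \<pi> r + i) mod m) mod m" by (rule injD[OF inj])
        with j(1) r(1) have "j = (inv \<pi> r + i) mod m"
          using Suc_mod_inj[of j m "(inv \<pi> r + i) mod m"] by simp
        then show False using i a(1) j(2) by (simp add: nth len)
      qed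
    qed
  qed
  have "inj_on \<Phi> ?G"
  proof (rule inj_onI)
    fix \<pi> \<sigma> assume \<pi>: "\<pi> \<in> ?G" and \<sigma>: "\<sigma> \<in> ?G" and eq: "\<Phi> \<pi> = \<Phi> \<sigma>"
    have "tl (L \<pi>) = tl (L \<sigma>)"
      using L(2,5)[OF \<pi>] L(2,5)[OF \<sigma>] eq chained_filter_inj[of S s r "tl (L \<pi>)" "tl (L \<sigma>)"]
      unfolding \<Phi>_def by auto
    then have LL: "L \<pi> = L \<sigma>" using L(2)[OF \<pi>] L(2)[OF \<sigma>] by simp
    have i0: "inv \<pi> r = inv \<sigma> r" using eq by (simp add: \<Phi>_def)
    show "\<pi> = \<sigma>"
    proof
      fix j
      show "\<pi> j = \<sigma> j"
      proof (cases "j < m")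
        case True
        let ?i = "(j + m - inv \<pi> r) mod m"
        have "(inv \<pi> r + ?i) mod m = j"
          using True L(1)[OF \<pi>] by (simp add: mod_add_right_eq)
        then show ?thesis
          using nth[of ?i \<pi>] nth[of ?i \<sigma>] LL i0 r(1) by simp
      next
        case False
        then show ?thesis using \<pi> \<sigma> by (auto simp: permutes_def)
      qed
    qed
  qed
  moreover have "\<Phi> ` ?G \<subseteq> {..<m} \<times> permutations_of_set ({..<m} - s ` S - {r})"
  proof (rule image_subsetI)
    fix \<pi> assume \<pi>: "\<pi> \<in> ?G"
    have "distinct (r # tl (L \<pi>))" "set (r # tl (L \<pi>)) = {..<m}"
      using L(3,4)[OF \<pi>] unfolding L(2)[OF \<pi>, symmetric] .
    then have "set (tl (L \<pi>)) = {..<m} - {r}" "distinct (tl (L \<pi>))" by auto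
    then show "\<Phi> \<pi> \<in> {..<m} \<times> permutations_of_set ({..<m} - s ` S - {r})"
      using L(1)[OF \<pi>] unfolding \<Phi>_def by (auto simp: permutations_of_set_def)
  qed
  ultimately have "card ?G \<le> card ({..<m} \<times> permutations_of_set ({..<m} - s ` S - {r}))"
    by (intro card_inj_on_le) auto
  also have "\<dots> = m * fact (card ({..<m} - s ` S - {r}))"
    by (simp add: card_cartesian_product)
  also have "card ({..<m} - s ` S - {r}) = m - 1 - card S"
    using r S(2) finS cs by (simp add: card_Diff_subset)
  finally show ?thesis .
qed

text \<open>Includes \<open>S = {..<m}\<close>, where no letter is free to serve as the cut.
  Forgetting the prescription at 0 reduces this to the previous case, and truncated subtraction
  makes both bounds \<open>m * fact 0\<close>.\<close>

lemma card_cyclic_orders: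
  assumes S: "S \<subseteq> {..<m}" "s ` S \<subseteq> {..<m}" "inj_on s S" and m: "0 < m"
  shows "card {\<pi>. \<pi> permutes {..<m} \<and> (\<forall>i<m. \<pi> i \<in> S \<longrightarrow> \<pi> (Suc i mod m) = s (\<pi> i))}
         \<le> m * fact (m - 1 - card S)"
proof (cases "card S < m")
  case True
  then show ?thesis using card_cyclic_orders_aux assms by blast
next
  case False
  then have Sm: "S = {..<m}"
    using S(1) card_mono[OF _ S(1)] by (intro card_subset_eq) simp_all
  let ?G = "\<lambda>S. {\<pi>. \<pi> permutes {..<m} \<and> (\<forall>i<m. \<pi> i \<in> S \<longrightarrow> \<pi> (Suc i mod m) = s (\<pi> i))}"
  let ?S = "S - {0}"
  have cS: "card ?S = m - 1" using Sm m by simp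
  have "card (?G ?S) \<le> m * fact (m - 1 - card ?S)"
  proof (rule card_cyclic_orders_aux)
    show "inj_on s ?S" using S(3) by (rule inj_on_subset) blast
  qed (use S(1,2) cS m in auto)
  moreover have "card (?G S) \<le> card (?G ?S)"
    by (intro card_mono finite_subset[OF _ finite_permutations[of "{..<m}"]]) auto
  ultimately show ?thesis using Sm cS by simp
qed

text \<open>Composition with the inverse of \<open>g\<close> turns agreement with \<open>g\<close>
  on \<open>S\<close> into fixing \<open>S\<close> pointwise.\<close>

lemma card_permutes_prescribed:
  assumes "finite A" "S \<subseteq> A" "g permutes A"
  shows "card {f. f permutes A \<and> (\<forall>a\<in>S. f a = g a)} \<le> fact (card A - card S)"
proof -
  let ?F = "{f. f permutes A \<and> (\<forall>a\<in>S. f a = g a)}"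
  have "card ?F \<le> card {h. h permutes (A - S)}"
  proof (rule card_inj_on_le)
    show "inj_on (\<lambda>f. inv g \<circ> f) ?F"
    proof (rule inj_onI)
      fix f f' assume "inv g \<circ> f = inv g \<circ> f'"
      then have "g \<circ> inv g \<circ> f = g \<circ> inv g \<circ> f'" by (simp only: comp_assoc)
      then show "f = f'" using permutes_inv_o(1)[OF assms(3)] by simp
    qed
    show "(\<lambda>f. inv g \<circ> f) ` ?F \<subseteq> {h. h permutes (A - S)}"
    proof clarify
      fix f assume f: "f permutes A" "\<forall>a\<in>S. f a = g a"
      have "(inv g \<circ> f) permutes A"
        using f(1) assms(3) by (intro permutes_compose permutes_inv)
      then show "(inv g \<circ> f) permutes (A - S)"
        by (rule permutes_superset) (use f(2) permutes_inverses(2)[OF assms(3)] in auto)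
    qed
  qed (use assms(1) in \<open>simp add: finite_permutations\<close>)
  also have "\<dots> = fact (card A - card S)"
    using assms by (subst card_permutations[OF refl]) (auto simp: card_Diff_subset finite_subset)
  finally show ?thesis .
qed

section \<open>A spread family of loose Hamilton cycles\<close>

text \<open>With \<open>d = k - 1\<close>, the \<open>m * d\<close> vertices are split into \<open>d\<close> classes of size \<open>m\<close>. The vertices of
  class \<open>0\<close> are the links shared by consecutive edges, and each edge has one interior vertex in
  every other class.\<close>

definition vertex :: "nat \<Rightarrow> nat \<Rightarrow> nat \<Rightarrow> nat" where
  "vertex d r a = Suc (a * d + r)"

lemma vertex_eq_iff:
  assumes "r < d" "r' < d"
  shows "vertex d r a = vertex d r' a' \<longleftrightarrow> r = r' \<and> a = a'"
proof
  assume "vertex d r a = vertex d r' a'"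
  then have eq: "r + a * d = r' + a' * d" by (simp add: vertex_def)
  then have "(r + a * d) mod d = (r' + a' * d) mod d" "(r + a * d) div d = (r' + a' * d) div d"
    by simp_all
  then show "r = r' \<and> a = a'" using assms by simp
qed simp

lemma inj_vertex: "r < d \<Longrightarrow> inj (vertex d r)"
  by (rule injI) (simp add: vertex_eq_iff)

lemma vertex_in_range:
  assumes "r < d" "a < m"
  shows "vertex d r a \<in> {1..m * d}"
proof -
  have "Suc a * d \<le> m * d" using assms by (intro mult_right_mono) auto
  then show ?thesis using assms by (auto simp: vertex_def)
qed

text \<open>\<open>fst w\<close> is the cyclic order of the links. \<open>snd w r\<close> attaches a
  vertex of class \<open>r\<close> to the first link of an edge rather than to its position, so an
  edge with known first link prescribes values of \<open>snd w r\<close> wherever it sits on the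
  cycle.\<close>

definition loose_edge :: "nat \<Rightarrow> nat \<Rightarrow> (nat \<Rightarrow> nat) \<times> (nat \<Rightarrow> nat \<Rightarrow> nat) \<Rightarrow> nat \<Rightarrow> nat set" where
  "loose_edge d m w i =
     vertex d 0 ` {fst w i, fst w (Suc i mod m)} \<union> (\<lambda>r. vertex d r (snd w r (fst w i))) ` {1..<d}"

definition loose_edges :: "nat \<Rightarrow> nat \<Rightarrow> (nat \<Rightarrow> nat) \<times> (nat \<Rightarrow> nat \<Rightarrow> nat) \<Rightarrow> nat set set" where
  "loose_edges d m w = loose_edge d m w ` {..<m}"

text \<open>Rotating the link order gives the same edge set, so a cycle arises from several pairs.
  Spread is measured for the uniform distribution on pairs, whose number is exactly a product of
  factorials.\<close>

definition loose_orders :: "nat \<Rightarrow> nat \<Rightarrow> ((nat \<Rightarrow> nat) \<times> (nat \<Rightarrow> nat \<Rightarrow> nat)) set" where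
  "loose_orders d m = {\<pi>. \<pi> permutes {..<m}} \<times> ({1..<d} \<rightarrow>\<^sub>E {f. f permutes {..<m}})"

lemma finite_loose_orders: "finite (loose_orders d m)"
  unfolding loose_orders_def by (intro finite_SigmaI finite_PiE finite_permutations) auto

lemma card_loose_orders:
  assumes "0 < d"
  shows "card (loose_orders d m) = fact m ^ d"
proof -
  have "card {f. f permutes {..<m}} = fact m"
    by (rule card_permutations) auto
  then have "card (loose_orders d m) = fact m * fact m ^ (d - 1)"
    unfolding loose_orders_def by (simp add: card_cartesian_product card_PiE)
  then show ?thesis using assms by (simp add: power_eq_if)
qed

lemma permutes_lessThan:
  assumes "\<pi> permutes {..<m::nat}" "i < m"
  shows "\<pi> i < m"
  using permutes_in_image[OF assms(1), of i] assms(2) by simp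

lemma loose_ordersD:
  assumes "w \<in> loose_orders d m"
  shows "fst w permutes {..<m}" "1 \<le> r \<Longrightarrow> r < d \<Longrightarrow> snd w r permutes {..<m}"
  using assms unfolding loose_orders_def by (auto dest: PiE_mem)

text \<open>The classes are disjoint, so an edge, seen merely as a set, reveals its pair of links
  though not their order.\<close>

lemma link_in_loose_edge_iff:
  assumes "0 < d"
  shows "vertex d 0 a \<in> loose_edge d m w i \<longleftrightarrow> a \<in> {fst w i, fst w (Suc i mod m)}"
proof -
  have "vertex d 0 a \<notin> (\<lambda>r. vertex d r (snd w r (fst w i))) ` {1..<d}"
    using assms by (auto simp: vertex_eq_iff)
  moreover have "vertex d 0 a \<in> vertex d 0 ` B \<longleftrightarrow> a \<in> B" for B
    using assms by (auto simp: vertex_eq_iff)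
  ultimately show ?thesis unfolding loose_edge_def by blast
qed

lemma interior_in_loose_edge_iff:
  assumes "1 \<le> r" "r < d"
  shows "vertex d r a \<in> loose_edge d m w i \<longleftrightarrow> a = snd w r (fst w i)"
  using assms by (auto simp: loose_edge_def vertex_eq_iff)

lemma loose_edge_in_k_subsets:
  assumes "w \<in> loose_orders d m" "2 \<le> m" "0 < d" "i < m"
  shows "loose_edge d m w i \<in> k_subsets (Suc d) {1..m * d}"
proof -
  note p = loose_ordersD[OF assms(1)]
  let ?I = "(\<lambda>r. vertex d r (snd w r (fst w i))) ` {1..<d}"
  let ?L = "vertex d 0 ` {fst w i, fst w (Suc i mod m)}"
  have lt: "fst w j < m" if "j < m" for j
    using permutes_lessThan[OF p(1) that] .
  have lt': "snd w r (fst w i) < m" if "1 \<le> r" "r < d" for r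
    using permutes_lessThan[OF p(2)[OF that] lt[OF assms(4)]] .
  have "loose_edge d m w i \<subseteq> {1..m * d}"
  proof
    fix x assume "x \<in> loose_edge d m w i"
    then consider j where "j < m" "x = vertex d 0 (fst w j)"
      | r where "1 \<le> r" "r < d" "x = vertex d r (snd w r (fst w i))"
      using assms mod_less_divisor[of m "Suc i"] unfolding loose_edge_def by fastforce
    then show "x \<in> {1..m * d}"
      using lt lt' vertex_in_range assms(3) by cases metis+
  qed
  moreover have "card (loose_edge d m w i) = Suc d"
  proof -
    \<comment> \<open>For \<open>m = 1\<close> both links of the edge would coincide.\<close>
    have "Suc i mod m \<noteq> i" using assms by (cases "Suc i = m") auto
    then have "fst w i \<noteq> fst w (Suc i mod m)"
      using inj_eq[OF permutes_inj[OF p(1)]] by metis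
    then have "card ?L = 2"
      using card_image[OF inj_on_subset[OF inj_vertex[OF assms(3)] subset_UNIV]] by (simp del: image_insert)
    moreover have "card ?I = d - 1"
    proof -
      have "inj_on (\<lambda>r. vertex d r (snd w r (fst w i))) {1..<d}"
        by (rule inj_onI) (simp add: vertex_eq_iff)
      from card_image[OF this] show ?thesis by simp
    qed
    moreover have "?L \<inter> ?I = {}"
    proof -
      have "vertex d 0 a \<noteq> vertex d r b" if "1 \<le> r" "r < d" for a r b
        using that assms(3) by (simp add: vertex_eq_iff)
      then show ?thesis by fastforce
    qed
    ultimately show ?thesis
      using assms(3) unfolding loose_edge_def by (subst card_Un_disjoint) auto
  qed
  ultimately show ?thesis by (simp add: k_subsets_def)
qed

section \<open>Loose orders yield loose Hamilton cycles\<close>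

lemma has_loose_hamilton_cycle_mono:
  assumes "has_loose_hamilton_cycle k V E" "E \<subseteq> E'"
  shows "has_loose_hamilton_cycle k V E'"
  using assms unfolding has_loose_hamilton_cycle_def by (meson subsetD)

text \<open>Position \<open>i * d + r\<close> receives the class \<open>r\<close> vertex of edge
  \<open>i\<close>. The segment of length \<open>d + 1\<close> from \<open>i * d\<close> is then
  edge \<open>i\<close>, ending at the link that opens the next edge.\<close>

lemma has_loose_hamilton_cycle_loose_edges:
  assumes w: "w \<in> loose_orders d m" and m: "3 \<le> m" and d: "2 \<le> d"
  shows "has_loose_hamilton_cycle (Suc d) {1..m * d} (loose_edges d m w)"
proof -
  note p = loose_ordersD[OF w]
  define pos where "pos r i = (if r = 0 then fst w i else snd w r (fst w i))" for r i
  define v where "v x = vertex d (x mod d) (pos (x mod d) (x div d))" for x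
  have v: "v (i * d + r) = vertex d r (pos r i)" if "r < d" for i r
    using that by (simp add: v_def)
  have pos_lt: "pos r i < m" if "r < d" "i < m" for r i
    using that permutes_lessThan[OF p(1)] permutes_lessThan[OF p(2)] by (auto simp: pos_def)
  have pos_inj: "i = j" if "r < d" "pos r i = pos r j" for r i j
    using that inj_eq[OF permutes_inj[OF p(1)]] inj_eq[OF permutes_inj[OF p(2)[of r]]]
    by (cases "r = 0") (simp_all add: pos_def)
  have bij: "bij_betw v {..<m * d} {1..m * d}"
  proof -
    have "inj_on v {..<m * d}"
    proof (rule inj_onI)
      fix x y assume eq: "v x = v y"
      have lt: "x mod d < d" "y mod d < d" using d by simp_all
      have *: "x mod d = y mod d \<and> pos (x mod d) (x div d) = pos (y mod d) (y div d)"
        using eq unfolding v_def vertex_eq_iff[OF lt] .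
      then have "pos (y mod d) (x div d) = pos (y mod d) (y div d)" by metis
      then have "x div d = y div d" using lt(2) pos_inj by blast
      with * show "x = y" by (metis div_mult_mod_eq)
    qed
    moreover have "v ` {..<m * d} \<subseteq> {1..m * d}"
    proof (rule image_subsetI)
      fix x assume "x \<in> {..<m * d}"
      then show "v x \<in> {1..m * d}"
        unfolding v_def using d by (intro vertex_in_range pos_lt) (auto simp: less_mult_imp_div_less)
    qed
    ultimately show ?thesis
      by (simp add: bij_betw_def card_image card_subset_eq)
  qed
  have seg: "cyclic_segment (m * d) v (Suc d) (i * d) = loose_edge d m w i" if i: "i < m" for i
  proof -
    have le: "Suc i * d \<le> m * d" using i by (intro mult_right_mono) auto
    have "{..<Suc d} = {0, d} \<union> {1..<d}" using d by auto
    then have "cyclic_segment (m * d) v (Suc d) (i * d) =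
        {v ((i * d + 0) mod (m * d)), v ((i * d + d) mod (m * d))} \<union>
        (\<lambda>j. v ((i * d + j) mod (m * d))) ` {1..<d}"
      unfolding cyclic_segment_def by (simp only: image_Un image_insert image_empty)
    moreover have "(i * d + j) mod (m * d) = i * d + j" if "j < d" for j
      using le that by (intro mod_less) simp
    moreover have "(i * d + d) mod (m * d) = (Suc i mod m) * d + 0"
      using mod_mult_mult2[of "Suc i" d m] by (simp add: add.commute)
    ultimately show ?thesis
      using d i v[of 0] v[of 0 i] v by (simp add: loose_edge_def pos_def mult.commute[of d])
  qed
  have inter: "loose_edge d m w i \<inter> loose_edge d m w (Suc i mod m)
      = {vertex d 0 (fst w (Suc i mod m))}" if i: "i < m" for i
  proof -
    let ?j = "Suc i mod m" and ?l = "Suc (Suc i mod m) mod m"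
    \<comment> \<open>For \<open>m = 2\<close> the edge after next would be edge \<open>i\<close>
      again, and two consecutive edges would share both links.\<close>
    have ne: "i \<noteq> ?j" "?l \<noteq> i" "?l \<noteq> ?j"
      using i m by (auto simp: mod_Suc split: if_splits)
    have pi: "fst w a = fst w b \<longleftrightarrow> a = b" for a b
      by (rule inj_eq[OF permutes_inj[OF p(1)]])
    have si: "snd w r (fst w a) = snd w r (fst w b) \<longleftrightarrow> a = b" if "1 \<le> r" "r < d" for r a b
      using inj_eq[OF permutes_inj[OF p(2)[OF that]]] pi by simp
    show ?thesis
    proof
      show "loose_edge d m w i \<inter> loose_edge d m w ?j \<subseteq> {vertex d 0 (fst w ?j)}"
      proof
        fix x assume x: "x \<in> loose_edge d m w i \<inter> loose_edge d m w ?j"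
        then consider a where "x = vertex d 0 a" | r a where "1 \<le> r" "r < d" "x = vertex d r a"
          unfolding loose_edge_def by auto
        then show "x \<in> {vertex d 0 (fst w ?j)}"
        proof cases
          case 1
          then have "a \<in> {fst w i, fst w ?j}" "a \<in> {fst w ?j, fst w ?l}"
            using x d by (simp_all add: link_in_loose_edge_iff)
          then show ?thesis using 1 ne pi by auto
        next
          case 2
          then show ?thesis using x ne si by (auto simp: interior_in_loose_edge_iff)
        qed
      qed
      show "{vertex d 0 (fst w ?j)} \<subseteq> loose_edge d m w i \<inter> loose_edge d m w ?j"
        using d by (simp add: link_in_loose_edge_iff)
    qed
  qed
  show ?thesis
    unfolding has_loose_hamilton_cycle_def
  proof (rule exI[of _ v], rule exI[of _ "\<lambda>i. i * d"], rule exI[of _ m], intro conjI allI impI)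
    show "strict_mono_on {..<m} (\<lambda>i. i * d)"
      using d by (auto simp: strict_mono_on_def)
    fix i assume i: "i < m"
    have j: "(i + 1) mod m < m" using m by simp
    show "cyclic_segment (card {1..m * d}) v (Suc d) (i * d) \<in> loose_edges d m w"
      using seg[OF i] i by (simp add: loose_edges_def)
    show "card (cyclic_segment (card {1..m * d}) v (Suc d) (i * d) \<inter>
        cyclic_segment (card {1..m * d}) v (Suc d) ((i + 1) mod m * d)) = 1"
      using seg[OF i] seg[OF j] inter[OF i] by simp
  qed (use bij m d in auto)
qed

text \<open>Guess for each edge of \<open>T\<close> which of its two links comes first, at a cost of
  \<open>2 ^ card T\<close>. The guess fixes the successors of \<open>card T\<close> links and, in
  each of the \<open>d - 1\<close> interior classes, the values of a permutation at these links; the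
  two previous counts then apply.\<close>

lemma card_loose_orders_containing:
  assumes m: "0 < m" and d: "0 < d"
  shows "card {w \<in> loose_orders d m. T \<subseteq> loose_edges d m w}
    \<le> 2 ^ card T * (m * fact (m - 1 - card T) * fact (m - card T) ^ (d - 1))"
    (is "card ?W \<le> 2 ^ card T * ?N")
proof (cases "?W = {}")
  case False
  then obtain w\<^sub>1 where w1: "w\<^sub>1 \<in> loose_orders d m" "T \<subseteq> loose_edges d m w\<^sub>1" by blast
  have finT: "finite T"
    using w1(2) unfolding loose_edges_def by (rule finite_subset) simp
  define links where "links e = {a. vertex d 0 a \<in> e}" for e
  have links: "links (loose_edge d m w i) = {fst w i, fst w (Suc i mod m)}" for w i
    using link_in_loose_edge_iff[OF d] by (auto simp: links_def)
  have links_T: "finite (links e)" "card (links e) \<le> 2" if e: "e \<in> T" for e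
  proof -
    obtain i where "e = loose_edge d m w\<^sub>1 i" using w1(2) e unfolding loose_edges_def by blast
    then have "links e = {fst w\<^sub>1 i, fst w\<^sub>1 (Suc i mod m)}" by (simp add: links)
    then show "finite (links e)" "card (links e) \<le> 2"
      by (simp_all add: card_insert_if)
  qed
  define A where "A src = {w \<in> loose_orders d m. \<forall>e\<in>T. \<exists>i<m. fst w i = src e \<and> e = loose_edge d m w i}" for src
  have cover: "?W \<subseteq> (\<Union>src\<in>Pi\<^sub>E T links. A src)"
  proof
    fix w assume w: "w \<in> ?W"
    then have "\<forall>e\<in>T. \<exists>i<m. e = loose_edge d m w i" by (auto simp: loose_edges_def)
    then obtain i where i: "\<And>e. e \<in> T \<Longrightarrow> i e < m \<and> e = loose_edge d m w (i e)" by metis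
    have "restrict (\<lambda>e. fst w (i e)) T \<in> Pi\<^sub>E T links"
    proof (rule restrict_PiE_iff[THEN iffD2], rule ballI)
      fix e assume "e \<in> T"
      then show "fst w (i e) \<in> links e" using i[of e] links[of w "i e"] by auto
    qed
    moreover have "w \<in> A (restrict (\<lambda>e. fst w (i e)) T)"
      using w i by (auto simp: A_def)
    ultimately show "w \<in> (\<Union>src\<in>Pi\<^sub>E T links. A src)" by blast
  qed
  have cardA: "card (A src) \<le> ?N" for src
  proof (cases "A src = {}")
    case False
    then obtain w\<^sub>0 where w0: "w\<^sub>0 \<in> A src" by blast
    then have w0': "w\<^sub>0 \<in> loose_orders d m" by (simp add: A_def)
    define \<pi>\<^sub>0 where "\<pi>\<^sub>0 = fst w\<^sub>0"
    note p = loose_ordersD[OF w0', folded \<pi>\<^sub>0_def]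
    define S where "S = src ` T"
    \<comment> \<open>One member of \<open>A src\<close> serves as reference: its successors and
      interior values on \<open>S\<close> are shared by all members.\<close>
    define s where "s a = \<pi>\<^sub>0 (Suc (inv \<pi>\<^sub>0 a) mod m)" for a
    obtain i\<^sub>0 where i0: "\<And>e. e \<in> T \<Longrightarrow> i\<^sub>0 e < m \<and> \<pi>\<^sub>0 (i\<^sub>0 e) = src e \<and> e = loose_edge d m w\<^sub>0 (i\<^sub>0 e)"
      using w0 unfolding A_def \<pi>\<^sub>0_def mem_Collect_eq by metis
    have s_src: "s (src e) = \<pi>\<^sub>0 (Suc (i\<^sub>0 e) mod m)" if "e \<in> T" for e
      using i0[OF that] permutes_inverses(2)[OF p(1)] unfolding s_def by metis
    \<comment> \<open>In the reference order, the first link determines the edge.\<close>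
    have inj: "inj_on src T"
    proof (rule inj_onI)
      fix e e' assume e: "e \<in> T" "e' \<in> T" "src e = src e'"
      then have "i\<^sub>0 e = i\<^sub>0 e'"
        using i0 injD[OF permutes_inj[OF p(1)]] by metis
      then show "e = e'" using i0 e by metis
    qed
    then have cS: "card S = card T" unfolding S_def by (rule card_image)
    have SX: "S \<subseteq> {..<m}"
      using i0 permutes_lessThan[OF p(1)] unfolding S_def by fastforce
    have sX: "s ` S \<subseteq> {..<m}"
      using permutes_lessThan[OF p(1)] m by (auto simp: s_def)
    have s_inj: "inj_on s S"
    proof (rule inj_onI)
      fix a b assume ab: "a \<in> S" "b \<in> S" "s a = s b"
      then have "Suc (inv \<pi>\<^sub>0 a) mod m = Suc (inv \<pi>\<^sub>0 b) mod m"
        using injD[OF permutes_inj[OF p(1)]] unfolding s_def by blast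
      then have "inv \<pi>\<^sub>0 a = inv \<pi>\<^sub>0 b"
        by (rule Suc_mod_inj[rotated 2]) (use ab SX permutes_lessThan[OF permutes_inv[OF p(1)]] in auto)
      then show "a = b" using permutes_inverses(1)[OF p(1)] by metis
    qed
    let ?G = "{\<pi>. \<pi> permutes {..<m} \<and> (\<forall>i<m. \<pi> i \<in> S \<longrightarrow> \<pi> (Suc i mod m) = s (\<pi> i))}"
    let ?B = "\<lambda>r. {f. f permutes {..<m} \<and> (\<forall>a\<in>S. f a = snd w\<^sub>0 r a)}"
    have "A src \<subseteq> ?G \<times> Pi\<^sub>E {1..<d} ?B"
    proof
      fix w assume wA: "w \<in> A src"
      then have w: "w \<in> loose_orders d m" by (simp add: A_def)
      note q = loose_ordersD[OF w]
      have common: "fst w (Suc i mod m) = s (fst w i) \<and>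
          (\<forall>r. 1 \<le> r \<longrightarrow> r < d \<longrightarrow> snd w r (fst w i) = snd w\<^sub>0 r (fst w i))"
        if "i < m" "fst w i \<in> S" for i
      proof -
        obtain e where e: "e \<in> T" "fst w i = src e" using \<open>fst w i \<in> S\<close> S_def by blast
        then obtain i' where i': "i' < m" "fst w i' = src e" "e = loose_edge d m w i'"
          using wA unfolding A_def by blast
        then have "i' = i" using e(2) injD[OF permutes_inj[OF q(1)]] by metis
        then have eq: "loose_edge d m w i = loose_edge d m w\<^sub>0 (i\<^sub>0 e)"
          using i' i0[OF e(1)] by simp
        have "{fst w i, fst w (Suc i mod m)} = {fst w i, s (fst w i)}"
          using arg_cong[OF eq, of links] i0[OF e(1)] s_src[OF e(1)] e(2)
          unfolding links by (simp add: \<pi>\<^sub>0_def)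
        \<comment> \<open>The two link pairs share their first entry, so the second entries agree
          too.\<close>
        then have "fst w (Suc i mod m) = s (fst w i)" by (auto simp: doubleton_eq_iff)
        moreover have "snd w r (fst w i) = snd w\<^sub>0 r (fst w i)" if "1 \<le> r" "r < d" for r
          using interior_in_loose_edge_iff[OF that, of _ m w i]
            interior_in_loose_edge_iff[OF that, of _ m w\<^sub>0 "i\<^sub>0 e"] eq i0[OF e(1)] e(2)
          unfolding \<pi>\<^sub>0_def by metis
        ultimately show ?thesis by blast
      qed
      have "snd w r a = snd w\<^sub>0 r a" if "1 \<le> r" "r < d" "a \<in> S" for r a
      proof -
        have "inv (fst w) a < m" "fst w (inv (fst w) a) = a"
          using permutes_lessThan[OF permutes_inv[OF q(1)]] SX that(3)
            permutes_inverses(1)[OF q(1)] by auto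
        then show ?thesis using common[of "inv (fst w) a"] that by simp
      qed
      moreover have "snd w \<in> {1..<d} \<rightarrow>\<^sub>E {f. f permutes {..<m}}"
        using w by (auto simp: loose_orders_def)
      ultimately have "snd w \<in> Pi\<^sub>E {1..<d} ?B"
        by (auto simp: PiE_iff)
      moreover have "fst w \<in> ?G" using q(1) common by blast
      ultimately show "w \<in> ?G \<times> Pi\<^sub>E {1..<d} ?B"
        by (simp add: mem_Times_iff)
    qed
    moreover have fin: "finite ?G" "finite (Pi\<^sub>E {1..<d} ?B)"
      using finite_permutations[of "{..<m}"]
      by (auto intro!: finite_PiE elim!: finite_subset[rotated])
    ultimately have "card (A src) \<le> card (?G \<times> Pi\<^sub>E {1..<d} ?B)"
      by (intro card_mono finite_cartesian_product)
    also have "\<dots> = card ?G * (\<Prod>r\<in>{1..<d}. card (?B r))"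
      by (simp add: card_cartesian_product card_PiE)
    also have "\<dots> \<le> (m * fact (m - 1 - card S)) * (\<Prod>r\<in>{1..<d}. fact (m - card S))"
    proof (intro mult_mono prod_mono conjI)
      show "card ?G \<le> m * fact (m - 1 - card S)"
        using SX sX s_inj m by (rule card_cyclic_orders)
      show "card (?B r) \<le> fact (m - card S)" if "r \<in> {1..<d}" for r
        using card_permutes_prescribed[OF _ SX p(2)[of r]] that by simp
    qed auto
    also have "\<dots> = ?N" by (simp add: cS)
    finally show ?thesis .
  qed simp
  have finPi: "finite (Pi\<^sub>E T links)" using finT links_T(1) by (intro finite_PiE)
  have "card ?W \<le> card (\<Union>src\<in>Pi\<^sub>E T links. A src)"
    using cover finPi finite_loose_orders[of d m]
    by (intro card_mono) (auto simp: A_def)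
  also have "\<dots> \<le> (\<Sum>src\<in>Pi\<^sub>E T links. card (A src))"
    by (rule card_UN_le[OF finPi])
  also have "\<dots> \<le> card (Pi\<^sub>E T links) * ?N"
    using sum_bounded_above[of "Pi\<^sub>E T links" "\<lambda>src. card (A src)" ?N] cardA by simp
  also have "card (Pi\<^sub>E T links) = (\<Prod>e\<in>T. card (links e))"
    by (rule card_PiE[OF finT])
  also have "\<dots> \<le> (\<Prod>e\<in>T. 2)"
    using links_T(2) by (intro prod_mono) auto
  also have "\<dots> = 2 ^ card T" by simp
  finally show ?thesis by (simp add: mult_right_mono)
next
  case True
  then show ?thesis by (simp only: card.empty le0)
qed

section \<open>The threshold\<close>

text \<open>Stirling-type comparison of a power with a falling factorial. The induction step rests
  on \<open>(1 + 1 / N) ^ u \<le> exp 1\<close> for \<open>N = s + u\<close>, valid since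
  \<open>u \<le> N\<close>.\<close>

lemma power_times_fact_le:
  "real (s + u) ^ u * fact s \<le> exp 1 ^ u * fact (s + u)"
proof (induction u)
  case (Suc u)
  let ?N = "s + u"
  have "real (Suc ?N) ^ u \<le> exp 1 * real ?N ^ u"
  proof (cases "?N = 0")
    case False
    then have "real ?N \<noteq> 0" by (subst of_nat_eq_0_iff)
    then have "real (Suc ?N) = (1 + 1 / real ?N) * real ?N"
      by (simp add: distrib_right del: of_nat_add)
    also have "\<dots> \<le> exp (1 / real ?N) * real ?N"
      by (intro mult_right_mono exp_ge_add_one_self) simp
    finally have "real (Suc ?N) ^ u \<le> (exp (1 / real ?N) * real ?N) ^ u"
      by (intro power_mono) auto
    also have "\<dots> = exp (real u / real ?N) * real ?N ^ u"
      by (simp add: power_mult_distrib flip: exp_of_nat_mult)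
    also have "\<dots> \<le> exp 1 * real ?N ^ u"
      using False by (intro mult_right_mono) auto
    finally show ?thesis .
  qed simp
  then have "real (Suc ?N) * (real (Suc ?N) ^ u * fact s) \<le> real (Suc ?N) * (exp 1 * real ?N ^ u * fact s)"
    by (intro mult_left_mono mult_right_mono) auto
  also have "\<dots> = real (Suc ?N) * exp 1 * (real ?N ^ u * fact s)" by simp
  also have "\<dots> \<le> real (Suc ?N) * exp 1 * (exp 1 ^ u * fact ?N)"
    using Suc by (intro mult_left_mono) auto
  finally show ?case by (simp add: mult_ac)
qed simp

lemma fact_diff_le:
  assumes "t \<le> m"
  shows "fact (m - t) \<le> (exp 1 / real m) ^ t * fact m"
proof (cases "m = 0")
  case False
  have "real m ^ t * fact (m - t) \<le> exp 1 ^ t * fact m"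
    using power_times_fact_le[of "m - t" t] assms by simp
  then show ?thesis using False by (simp add: power_divide field_simps)
qed (use assms in simp)

text \<open>For \<open>t < m\<close>, replacing \<open>m\<close> by \<open>m - 1\<close> costs a
  factor of at most \<open>2 ^ t\<close>. At \<open>t = m\<close> truncated subtraction gives
  \<open>fact 0\<close>, and the surplus factor \<open>m\<close> is paid by another
  \<open>2 ^ m\<close>; hence the constant 4.\<close>

lemma mult_fact_pred_diff_le:
  assumes "t \<le> m" "0 < m"
  shows "real m * fact (m - 1 - t) \<le> (4 * exp 1 / real m) ^ t * fact m"
proof -
  have "real m ^ t * (real m * fact (m - 1 - t)) \<le> (4 * exp 1) ^ t * fact m"
  proof (cases "t \<le> m - 1")
    case True
    let ?N = "m - 1"
    have m_le: "real m ^ t \<le> (2 * real ?N) ^ t"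
    proof (cases "t = 0")
      case False
      then show ?thesis using True by (intro power_mono) auto
    qed simp
    have "real m ^ t * (real m * fact (?N - t)) \<le> (2 * real ?N) ^ t * (real m * fact (?N - t))"
      using m_le by (rule mult_right_mono) simp
    also have "\<dots> = 2 ^ t * real m * (real ?N ^ t * fact (?N - t))"
      by (simp add: power_mult_distrib)
    also have "\<dots> \<le> 2 ^ t * real m * (exp 1 ^ t * fact ?N)"
      using power_times_fact_le[of "?N - t" t] unfolding le_add_diff_inverse2[OF True]
      by (intro mult_left_mono) auto
    also have "\<dots> = (2 * exp 1) ^ t * fact m"
      using assms(2) by (simp add: fact_reduce[of m] power_mult_distrib)
    also have "\<dots> \<le> (4 * exp 1) ^ t * fact m"
      by (intro mult_right_mono power_mono) auto
    finally show ?thesis .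
  next
    case False
    then have t: "t = m" using assms by simp
    obtain N where N: "m = Suc N" using assms(2) by (cases m) auto
    have "real m ^ N \<le> 2 ^ N * real N ^ N"
    proof (cases "N = 0")
      case False
      then have "real m ^ N \<le> (2 * real N) ^ N" using N by (intro power_mono) auto
      then show ?thesis by (simp add: power_mult_distrib)
    qed simp
    also have "\<dots> \<le> 2 ^ N * (exp 1 ^ N * fact N)"
      using power_times_fact_le[of 0 N] by (intro mult_left_mono) auto
    finally have *: "real m ^ N \<le> 2 ^ N * (exp 1 ^ N * fact N)" .
    have "real m \<le> 2 ^ m" using of_nat_less_two_power[of m] by (rule less_imp_le)
    have "real m ^ t * (real m * fact (m - 1 - t)) = real m * (real m * real m ^ N)"
      using t N by simp
    also have "\<dots> \<le> 2 ^ m * (real m * (2 ^ N * (exp 1 ^ N * fact N)))"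
      using * \<open>real m \<le> 2 ^ m\<close> by (intro mult_mono mult_left_mono) auto
    also have "\<dots> = 2 ^ m * 2 ^ N * exp 1 ^ N * fact m"
      by (simp add: N)
    also have "\<dots> \<le> 2 ^ m * 2 ^ m * exp 1 ^ m * fact m"
      using N by (intro mult_right_mono mult_mono power_increasing) auto
    also have "\<dots> = (4 * exp 1) ^ t * fact m"
      by (simp add: t power_mult_distrib flip: power_mult_distrib[of 2 2])
    finally show ?thesis .
  qed
  then show ?thesis using assms(2) by (simp add: power_divide field_simps)
qed

text \<open>Each of the \<open>d\<close> permutations contributes a factor of at most
  \<open>4 * exp 1 / m\<close> per edge of \<open>T\<close>, and the guess of its first link a
  factor 2.\<close>

lemma loose_orders_spread:
  assumes m: "0 < m" and d: "0 < d"
  shows "real (card {w \<in> loose_orders d m. T \<subseteq> loose_edges d m w})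
    \<le> (2 * (4 * exp 1) ^ d / real m ^ d) ^ card T * card (loose_orders d m)"
proof (cases "{w \<in> loose_orders d m. T \<subseteq> loose_edges d m w} = {}")
  case False
  then obtain w where w: "T \<subseteq> loose_edges d m w" by blast
  let ?t = "card T" and ?c = "4 * exp 1 / real m"
  have "finite (loose_edges d m w)" "card (loose_edges d m w) \<le> m"
    using card_image_le[of "{..<m}" "loose_edge d m w"] by (simp_all add: loose_edges_def)
  then have t: "?t \<le> m" using card_mono[OF _ w] by linarith
  have "real (card {w \<in> loose_orders d m. T \<subseteq> loose_edges d m w})
      \<le> 2 ^ ?t * ((real m * fact (m - 1 - ?t)) * fact (m - ?t) ^ (d - 1))"
    using card_loose_orders_containing[OF m d, of T]
    by (metis (mono_tags, lifting) of_nat_le_iff of_nat_fact of_nat_mult of_nat_numeral of_nat_power)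
  also have "\<dots> \<le> 2 ^ ?t * ((?c ^ ?t * fact m) * (?c ^ ?t * fact m) ^ (d - 1))"
  proof -
    have "fact (m - ?t) \<le> (exp 1 / real m) ^ ?t * fact m" by (rule fact_diff_le[OF t])
    also have "\<dots> \<le> ?c ^ ?t * fact m"
      by (intro mult_right_mono power_mono divide_right_mono) auto
    finally have "fact (m - ?t) ^ (d - 1) \<le> (?c ^ ?t * fact m) ^ (d - 1)"
      by (rule power_mono) simp
    from mult_mono[OF mult_fact_pred_diff_le[OF t m] this] show ?thesis
      by (intro mult_left_mono) auto
  qed
  also have "\<dots> = 2 ^ ?t * (?c ^ ?t * fact m) ^ d"
    using d by (simp add: power_eq_if)
  also have "\<dots> = 2 ^ ?t * (?c ^ d) ^ ?t * fact m ^ d"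
    by (simp add: power_mult_distrib mult.commute flip: power_mult)
  also have "\<dots> = (2 * (4 * exp 1) ^ d / real m ^ d) ^ ?t * card (loose_orders d m)"
    by (simp add: card_loose_orders[OF d] power_divide power_mult_distrib)
  finally show ?thesis .
qed (use m in \<open>simp only: card.empty, simp\<close>)

section \<open>From the spread family to the limits\<close>

lemma random_hypergraph_eq: "random_hypergraph k n p = random_subset (k_subsets k {1..n}) p"
  by (simp add: random_hypergraph_def random_subset_def)

lemma finite_k_subsets: "finite V \<Longrightarrow> finite (k_subsets k V)"
  unfolding k_subsets_def by simp

text \<open>Rounds of density \<open>4 * q / y\<close>, logarithmically many in \<open>m\<close>,
  suffice, as the targets have at most \<open>m\<close> edges and are \<open>q\<close>-spread. Both
  parts of the theorem follow from this one bound, with \<open>c\<close> independent of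
  \<open>n\<close> and \<open>p\<close>.\<close>

lemma loose_hamilton_threshold:
  fixes d :: nat and \<epsilon> :: real
  assumes d: "2 \<le> d" and \<epsilon>: "0 < \<epsilon>"
  obtains c where "c > 0" "\<And>n p. d dvd n \<Longrightarrow> 3 * d \<le> n \<Longrightarrow> p \<le> 1 \<Longrightarrow> c * ln (real n) / real n ^ d \<le> p \<Longrightarrow>
    measure_pmf.prob (random_hypergraph (Suc d) n p) {H. has_loose_hamilton_cycle (Suc d) {1..n} H} \<ge> 1 - \<epsilon>"
proof -
  define y where "y = min (1 / 2) (\<epsilon> / 2)"
  define K where "K = 2 * (4 * exp 1 :: real) ^ d"
  \<comment> \<open>Chosen so that \<open>ln n / ln 2\<close> rounds of density
    \<open>4 * q / y\<close> add up to \<open>c * ln n / n ^ d\<close>; the factor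
    \<open>d ^ d\<close> comes from \<open>m = n / d\<close>.\<close>
  define c where "c = 4 * K * real d ^ d / (y * ln 2)"
  have y: "0 < y" "y \<le> 1 / 2" "2 * y \<le> \<epsilon>" using \<epsilon> by (auto simp: y_def)
  have K: "0 < K" by (simp add: K_def)
  show ?thesis
  proof (rule that[of c])
    show "c > 0" using y K d by (simp add: c_def)
    fix n :: nat and p :: real
    assume "d dvd n" "3 * d \<le> n" and p: "p \<le> 1" "c * ln (real n) / real n ^ d \<le> p"
    then obtain m where n: "n = m * d" by (auto simp: dvd_def mult.commute)
    with \<open>3 * d \<le> n\<close> d have m: "3 \<le> m" by simp
    obtain j where j: "2 ^ j \<le> m" "m < 2 ^ (j + 1)"
      using ex_power_ivl1[of 2 m] m by auto
    define M where "M = j + 1"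
    define q where "q = K / real m ^ d"
    define p\<^sub>0 where "p\<^sub>0 = 4 * q / y"
    have p0: "0 < p\<^sub>0" using K y m by (simp add: p\<^sub>0_def q_def)
    have "real M * ln 2 \<le> ln (real n)"
    proof -
      \<comment> \<open>The extra round beyond the exponent \<open>j\<close> is absorbed by
        \<open>d \<ge> 2\<close>.\<close>
      have "(2::nat) ^ M \<le> m * d"
        using j(1) d mult_mono[of "2 ^ j" m 2 d] by (simp add: M_def mult.commute)
      then have "(2::real) ^ M \<le> real n"
        unfolding n by (metis of_nat_le_iff of_nat_numeral of_nat_power)
      then have "ln (2 ^ M) \<le> ln (real n)" by (subst ln_le_cancel_iff) (use m d n in auto)
      then show ?thesis by (simp add: ln_realpow)
    qed
    then have "real M \<le> ln (real n) / ln 2" by (simp add: field_simps)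
    then have "real M * p\<^sub>0 \<le> ln (real n) / ln 2 * p\<^sub>0"
      using p0 by (intro mult_right_mono) auto
    also have "\<dots> = c * ln (real n) / real n ^ d"
      using d m by (simp add: c_def p\<^sub>0_def q_def n power_mult_distrib mult_ac)
    finally have Mp: "real M * p\<^sub>0 \<le> p" using p(2) by simp
    have "p\<^sub>0 \<le> real M * p\<^sub>0" using p0 by (simp add: M_def)
    then have p01: "p\<^sub>0 \<le> 1" using Mp p(1) by simp
    let ?X = "k_subsets (Suc d) {1..n}"
    have "1 - 2 * y \<le> containment_prob ?X p (loose_edges d m ` loose_orders d m)"
    proof (rule spread_containment)
      show "finite ?X" by (simp add: finite_k_subsets)
      show "finite (loose_orders d m)" by (rule finite_loose_orders)
      show "loose_orders d m \<noteq> {}"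
        using card_loose_orders[of d m] d by (auto simp: card_eq_0_iff)
      show "loose_edges d m w \<subseteq> ?X" if "w \<in> loose_orders d m" for w
        using loose_edge_in_k_subsets[OF that] m d by (auto simp: loose_edges_def n)
      show "card (loose_edges d m w) \<le> m" for w
        using card_image_le[of "{..<m}" "loose_edge d m w"] by (simp add: loose_edges_def)
      show "real (card {w \<in> loose_orders d m. T \<subseteq> loose_edges d m w})
          \<le> q ^ card T * real (card (loose_orders d m))" for T
        using loose_orders_spread[of m d T] m d by (simp add: q_def K_def)
      show "0 < p\<^sub>0" "p\<^sub>0 \<le> 1" "real M * p\<^sub>0 \<le> p" "p \<le> 1" by fact+
      show "0 \<le> q" "4 * q \<le> y * p\<^sub>0" using K y by (simp_all add: q_def p\<^sub>0_def)
      show "0 \<le> y" "y \<le> 1 / 2" using y by simp_all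
      show "m < 2 ^ M" using j by (simp add: M_def)
    qed
    also have "\<dots> \<le> measure_pmf.prob (random_hypergraph (Suc d) n p) {H. has_loose_hamilton_cycle (Suc d) {1..n} H}"
      unfolding containment_prob_def random_hypergraph_eq
    proof (rule measure_pmf.finite_measure_mono)
      show "{W. \<exists>S\<in>loose_edges d m ` loose_orders d m. S \<subseteq> W} \<subseteq> {H. has_loose_hamilton_cycle (Suc d) {1..n} H}"
        using has_loose_hamilton_cycle_mono[OF has_loose_hamilton_cycle_loose_edges[OF _ m d]]
        by (auto simp: n)
    qed simp
    finally show "1 - \<epsilon> \<le> measure_pmf.prob (random_hypergraph (Suc d) n p)
        {H. has_loose_hamilton_cycle (Suc d) {1..n} H}"
      using y(3) by linarith
  qed
qed

lemma eventually_multiples_at_top: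
  assumes "eventually P sequentially"
  shows "\<forall>\<^sub>F n in multiples_at_top d. d dvd n \<and> P n"
  using assms unfolding multiples_at_top_def eventually_inf_principal
  by eventually_elim auto

theorem theorem1p2:
  "(\<forall>\<epsilon>::real. \<epsilon> > 0 \<longrightarrow>
      (\<exists>c::real. c > 0 \<and>
        (\<forall>p::nat \<Rightarrow> real.
           (\<forall>n. 0 \<le> p n \<and> p n \<le> 1) \<longrightarrow>
           (\<forall>\<^sub>F n in sequentially. p n \<ge> c * ln (real n) / real n ^ 2) \<longrightarrow>
           Liminf (multiples_at_top 2)
             (\<lambda>n. ereal (measure_pmf.prob (random_hypergraph 3 n (p n))
                          {H. has_loose_hamilton_cycle 3 {1..n} H}))
             \<ge> ereal (1 - \<epsilon>))))
   \<and>
   (\<forall>(k::nat) (p::nat \<Rightarrow> real).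
      k \<ge> 4 \<longrightarrow>
      (\<forall>n. 0 \<le> p n \<and> p n \<le> 1) \<longrightarrow>
      filterlim (\<lambda>n. p n * real n ^ (k - 1) / ln (real n)) at_top sequentially \<longrightarrow>
      ((\<lambda>n. measure_pmf.prob (random_hypergraph k n (p n))
              {H. has_loose_hamilton_cycle k {1..n} H}) \<longlongrightarrow> 1)
        (multiples_at_top (k - 1)))"
proof (intro conjI allI impI)
  fix \<epsilon> :: real assume "\<epsilon> > 0"
  then obtain c where c: "c > 0" "\<And>n p. 2 dvd n \<Longrightarrow> 3 * 2 \<le> n \<Longrightarrow> p \<le> 1 \<Longrightarrow> c * ln (real n) / real n ^ 2 \<le> p \<Longrightarrow>
      measure_pmf.prob (random_hypergraph (Suc 2) n p) {H. has_loose_hamilton_cycle (Suc 2) {1..n} H} \<ge> 1 - \<epsilon>"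
    using loose_hamilton_threshold[of 2 \<epsilon>] by blast
  show "\<exists>c::real. c > 0 \<and>
        (\<forall>p::nat \<Rightarrow> real.
           (\<forall>n. 0 \<le> p n \<and> p n \<le> 1) \<longrightarrow>
           (\<forall>\<^sub>F n in sequentially. p n \<ge> c * ln (real n) / real n ^ 2) \<longrightarrow>
           Liminf (multiples_at_top 2)
             (\<lambda>n. ereal (measure_pmf.prob (random_hypergraph 3 n (p n))
                          {H. has_loose_hamilton_cycle 3 {1..n} H}))
             \<ge> ereal (1 - \<epsilon>))"
  proof (intro exI[of _ c] conjI allI impI)
    fix p :: "nat \<Rightarrow> real"
    assume p: "\<forall>n. 0 \<le> p n \<and> p n \<le> 1"
      and ev: "\<forall>\<^sub>F n in sequentially. p n \<ge> c * ln (real n) / real n ^ 2"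
    \<comment> \<open>The bound 6 is \<open>3 * d\<close> for \<open>d = 2\<close>: the cycle needs
      three edges.\<close>
    have "\<forall>\<^sub>F n in sequentially. p n \<ge> c * ln (real n) / real n ^ 2 \<and> 6 \<le> n"
      using ev eventually_ge_at_top[of 6] by (rule eventually_conj)
    from eventually_multiples_at_top[OF this, of 2]
    show "Liminf (multiples_at_top 2)
             (\<lambda>n. ereal (measure_pmf.prob (random_hypergraph 3 n (p n))
                          {H. has_loose_hamilton_cycle 3 {1..n} H})) \<ge> ereal (1 - \<epsilon>)"
    proof (intro Liminf_bounded, eventually_elim)
      case (elim n)
      then show ?case using c(2)[of n "p n"] p by (simp add: numeral_3_eq_3)
    qed
  qed (rule c(1))
next
  fix k :: nat and p :: "nat \<Rightarrow> real"
  assume k: "k \<ge> 4" and p: "\<forall>n. 0 \<le> p n \<and> p n \<le> 1"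
    and lim: "filterlim (\<lambda>n. p n * real n ^ (k - 1) / ln (real n)) at_top sequentially"
  show "((\<lambda>n. measure_pmf.prob (random_hypergraph k n (p n))
              {H. has_loose_hamilton_cycle k {1..n} H}) \<longlongrightarrow> 1) (multiples_at_top (k - 1))"
  proof (rule tendstoI)
    fix e :: real assume "e > 0"
    define d where "d = k - 1"
    have d: "2 \<le> d" "k = Suc d" using k by (auto simp: d_def)
    obtain c where c: "c > 0" "\<And>n p. d dvd n \<Longrightarrow> 3 * d \<le> n \<Longrightarrow> p \<le> 1 \<Longrightarrow> c * ln (real n) / real n ^ d \<le> p \<Longrightarrow>
      measure_pmf.prob (random_hypergraph (Suc d) n p) {H. has_loose_hamilton_cycle (Suc d) {1..n} H} \<ge> 1 - e / 2"
      using loose_hamilton_threshold[of d "e / 2"] d \<open>e > 0\<close> by auto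
    \<comment> \<open>The constant \<open>c\<close> grows as \<open>e\<close> shrinks, but a ratio
      tending to infinity eventually exceeds it for each fixed \<open>e\<close>.\<close>
    have "\<forall>\<^sub>F n in sequentially. c \<le> p n * real n ^ d / ln (real n) \<and> 3 * d \<le> n"
      using lim eventually_ge_at_top[of "3 * d"] unfolding filterlim_at_top d_def
      by (intro eventually_conj) auto
    from eventually_multiples_at_top[OF this, of d]
    show "\<forall>\<^sub>F n in multiples_at_top (k - 1). dist (measure_pmf.prob (random_hypergraph k n (p n))
              {H. has_loose_hamilton_cycle k {1..n} H}) 1 < e"
      unfolding d_def[symmetric]
    proof eventually_elim
      case (elim n)
      then have n: "1 < n" using d by linarith
      then have "0 < ln (real n)" by simp
      then have "c * ln (real n) / real n ^ d \<le> p n" using elim n by (simp add: field_simps)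
      then have "1 - e / 2 \<le> measure_pmf.prob (random_hypergraph k n (p n)) {H. has_loose_hamilton_cycle k {1..n} H}"
        using c(2)[of n "p n"] p elim d(2) by simp
      then show ?case
        using \<open>e > 0\<close> measure_pmf.prob_le_1[of "random_hypergraph k n (p n)" "{H. has_loose_hamilton_cycle k {1..n} H}"]
        unfolding dist_real_def by linarith
    qed
  qed
qed

end
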